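(* There is an uncountable family $\mathcal H$ of fans such that: (i) any two distinct members of $\mathcal H$ are not homeomorphic; (ii) every $X\in\mathcal H$ is not smooth; and (iii) every $X\in\mathcal H$ admits a transitive homeomorphism, i.e., there is a homeomorphism $f:X\to X$ such that for all non-empty open sets $U,V\subseteq X$ there is a non-negative integer $n$ with $f^n(U)\cap V\neq\emptyset$.
   Context: A continuum is a non-empty compact connected metric space; a subcontinuum of a continuum is a subspace that is itself a continuum. A continuum $X$ is unicoherent if for any subcontinua $A,B$ of $X$ with $X=A\cup B$, the set $A\cap B$ is connected; it is hereditarily unicoherent if each of its subcontinua is unicoherent. A dendroid is an arcwise connected, hereditarily unicoherent continuum. An arc is a space homeomorphic to $[0,1]$. A simple triod is a space homeomorphic to $([-1,1]\times\{0\})\cup(\{0\}\times[0,1])$; a point $x$ of a simple triod $T$ is its top if some homeomorphism from $([-1,1]\times\{0\})\cup(\{0\}\times[0,1])$ onto $T$ maps $(0,0)$ to $x$. A point $x$ of a dendroid $X$ is a ramification point of $X$ if there is a simple triod contained in $X$ whose top is $x$. A fan is a dendroid with at most one ramification point; this point, if it exists, is called the top of the fan. For points $x,y$ of a fan $X$, $A_X[x,y]$ denotes the (unique) arc in $X$ with end-points $x$ and $y$ if $x\neq y$, and $A_X[x,x]=\{x\}$. A fan $X$ with top $v$ is smooth if for every $x\in X$ and every sequence $(x_n)$ of points of $X$ with $\lim_{n\to\infty}x_n=x$, one has $\lim_{n\to\infty}A_X[v,x_n]=A_X[v,x]$ with respect to the Hausdorff metric on the non-empty closed subsets of $X$. 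*)

theory Defs
  imports "HOL-Analysis.Analysis"
begin

definition continuum :: "'a::metric_space set \<Rightarrow> bool" where
  "continuum X \<longleftrightarrow> X \<noteq> {} \<and> compact X \<and> connected X"

(* The library constant unicoherent quantifies over relatively closed connected sets A, B with
   A Un B = Y. For a continuum Y the non-empty ones among them are exactly the subcontinua of Y,
   and the empty set never violates connectedness of the intersection. *)

definition hereditarily_unicoherent :: "'a::metric_space set \<Rightarrow> bool" where
  "hereditarily_unicoherent X \<longleftrightarrow> (\<forall>Y. Y \<subseteq> X \<and> continuum Y \<longrightarrow> unicoherent Y)"

definition arc_with_ends :: "'a::metric_space \<Rightarrow> 'a \<Rightarrow> 'a set \<Rightarrow> bool" where
  "arc_with_ends x y A \<longleftrightarrow> (\<exists>g. arc g \<and> path_image g = A \<and> pathstart g = x \<and> pathfinish g = y)"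

definition arcwise_connected :: "'a::metric_space set \<Rightarrow> bool" where
  "arcwise_connected X \<longleftrightarrow>
     (\<forall>x\<in>X. \<forall>y\<in>X. x \<noteq> y \<longrightarrow> (\<exists>A\<subseteq>X. arc_with_ends x y A))"

definition dendroid :: "'a::metric_space set \<Rightarrow> bool" where
  "dendroid X \<longleftrightarrow> continuum X \<and> arcwise_connected X \<and> hereditarily_unicoherent X"

definition standard_triod :: "(real \<times> real) set" where
  "standard_triod = ({-1..1} \<times> {0}) \<union> ({0} \<times> {0..1})"

definition triod_with_top :: "'a::metric_space set \<Rightarrow> 'a \<Rightarrow> bool" where
  "triod_with_top T x \<longleftrightarrow> (\<exists>h k. homeomorphism standard_triod T h k \<and> h (0, 0) = x)"

definition ramification_point :: "'a::metric_space set \<Rightarrow> 'a \<Rightarrow> bool" where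
  "ramification_point X x \<longleftrightarrow> (\<exists>T\<subseteq>X. triod_with_top T x)"

definition fan :: "'a::metric_space set \<Rightarrow> bool" where
  "fan X \<longleftrightarrow> dendroid X \<and>
     (\<forall>x y. ramification_point X x \<and> ramification_point X y \<longrightarrow> x = y)"

definition is_top :: "'a::metric_space set \<Rightarrow> 'a \<Rightarrow> bool" where
  "is_top X v \<longleftrightarrow> fan X \<and> ramification_point X v"

(* Meaningful when X is uniquely arcwise connected, in particular when X is a dendroid. *)
definition arc_in :: "'a::metric_space set \<Rightarrow> 'a \<Rightarrow> 'a \<Rightarrow> 'a set" where
  "arc_in X x y = (if x = y then {x} else (THE A. A \<subseteq> X \<and> arc_with_ends x y A))"

(* The Hausdorff metric; meaningful for non-empty bounded closed sets. *)
definition hausdorff_dist :: "'a::metric_space set \<Rightarrow> 'a set \<Rightarrow> real" where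
  "hausdorff_dist A B = max (SUP a\<in>A. infdist a B) (SUP b\<in>B. infdist b A)"

definition smooth_at_top :: "'a::metric_space set \<Rightarrow> 'a \<Rightarrow> bool" where
  "smooth_at_top X v \<longleftrightarrow>
     (\<forall>x\<in>X. \<forall>s. (\<forall>n. s n \<in> X) \<and> s \<longlonglongrightarrow> x \<longrightarrow>
        (\<lambda>n. hausdorff_dist (arc_in X v (s n)) (arc_in X v x)) \<longlonglongrightarrow> 0)"

(* Smoothness is a notion for fans that have a top. "Not smooth" therefore asks for the top to
   exist and for the convergence condition to fail; a fan without a top does not qualify. *)
definition nonsmooth_fan :: "'a::metric_space set \<Rightarrow> bool" where
  "nonsmooth_fan X \<longleftrightarrow> (\<exists>v. is_top X v \<and> \<not> smooth_at_top X v)"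

definition transitive_homeomorphism :: "'a::metric_space set \<Rightarrow> ('a \<Rightarrow> 'a) \<Rightarrow> bool" where
  "transitive_homeomorphism X f \<longleftrightarrow>
     (\<exists>g. homeomorphism X X f g) \<and>
     (\<forall>U V. openin (top_of_set X) U \<and> U \<noteq> {} \<and> openin (top_of_set X) V \<and> V \<noteq> {} \<longrightarrow>
        (\<exists>n. (f ^^ n) ` U \<inter> V \<noteq> {}))"

end

theory Submission
  imports Defs
begin

text \<open>
  Let \<open>A = {0} \<union> {1/k, -1/k | k \<ge> 1}\<close> and \<open>C\<close> be the set of all functions from the integers to \<open>A\<close>. On the fan
  over \<open>C\<close> the skew product of the shift with \<open>t \<mapsto> \<Phi> t (c 0)\<close>, where \<open>\<Phi>\<close> is the flow of translations of
  \<open>[0,1]\<close>, is a transitive homeomorphism: a word \<open>(1/k, ..., 1/k)\<close> or its negative, spliced between two codes,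
  adjusts the height by any amount up to an error \<open>1/k\<close>. It is the identity on the leg of the zero code, so it
  descends to the quotient in which that leg alone is folded by an arbitrary continuous surjection \<open>g\<close> of
  \<open>[0,1]\<close> with \<open>g 0 = 0\<close>. The quotient is the set of all points \<open>(g t, t * c)\<close>. It is a fan because, by boundary
  bumping, each of its subcontinua either contains the top and is closed downwards, or lies in a single leg.

  The neighbouring legs follow the folds of \<open>g\<close>. Hence the closure of the order ``\<open>y\<close> lies on the arc from the
  top to \<open>x\<close>'' strictly extends the order exactly when \<open>g\<close> is not monotone, which makes the fan non-smooth, and
  the pairs gained recover the position of the folds up to an increasing bijection. Taking infinitely many
  folds, where the \<open>n\<close>-th one touches the next one if and only if \<open>n \<in> E\<close>, distinguishes all subsets \<open>E\<close> of the
  natural numbers.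
\<close>

section \<open>Fans built from legs\<close>

text \<open>The topology enters through compactness and \<open>one_leg\<close>: a connected set that
  misses the top stays in one leg. Continuity is asked of each leg separately, not jointly in leg
  and parameter, so a folded leg may carry a parameter of its own while its neighbours follow the
  folds.\<close>

locale hedgehog =
  fixes X :: "'a::metric_space set" and v :: 'a and I :: "'i set" and lam :: "'i \<Rightarrow> real \<Rightarrow> 'a"
  assumes compact_space: "compact X"
    and cover: "X = (\<Union>c\<in>I. lam c ` {0..1})"
    and cont: "c \<in> I \<Longrightarrow> continuous_on {0..1} (lam c)"
    and base [simp]: "c \<in> I \<Longrightarrow> lam c 0 = v"
    and inj: "\<lbrakk>c \<in> I; d \<in> I; s \<in> {0..1}; t \<in> {0..1}; lam c s = lam d t\<rbrakk> \<Longrightarrow> s = t \<and> (s = 0 \<or> c = d)"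
    and one_leg: "\<lbrakk>K \<subseteq> X; connected K; v \<notin> K; K \<noteq> {}\<rbrakk> \<Longrightarrow> \<exists>c\<in>I. K \<subseteq> lam c ` {0..1}"
    and three_legs: "\<exists>c\<in>I. \<exists>d\<in>I. \<exists>e\<in>I. c \<noteq> d \<and> c \<noteq> e \<and> d \<noteq> e"
begin

lemma in_X: "c \<in> I \<Longrightarrow> s \<in> {0..1} \<Longrightarrow> lam c s \<in> X"
  using cover by blast

lemma X_cases:
  assumes "x \<in> X"
  obtains c s where "c \<in> I" "s \<in> {0..1}" "x = lam c s"
  using assms cover by blast

lemma v_in_X: "v \<in> X"
  using three_legs in_X[of _ 0] by auto

lemma eq_v_iff: "c \<in> I \<Longrightarrow> s \<in> {0..1} \<Longrightarrow> lam c s = v \<longleftrightarrow> s = 0"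
  using inj[of c c s 0] by auto

lemma cont_sub: "c \<in> I \<Longrightarrow> A \<subseteq> {0..1} \<Longrightarrow> continuous_on A (lam c)"
  using cont continuous_on_subset by blast

lemma inj_leg: "c \<in> I \<Longrightarrow> inj_on (lam c) {0..1}"
  using inj by (auto simp: inj_on_def)

lemma leg_inverse:
  assumes "c \<in> I"
  obtains k where "continuous_on (lam c ` {0..1}) k" "\<And>s. s \<in> {0..1} \<Longrightarrow> k (lam c s) = s"
proof -
  obtain k where "homeomorphism {0..1} (lam c ` {0..1}) (lam c) k"
    using homeomorphism_compact[OF compact_Icc cont[OF assms] refl inj_leg[OF assms]] by blast
  then show thesis using that[of k] by (auto simp: homeomorphism_def)
qed

section \<open>Connected subsets and subcontinua of a hedgehog\<close>

lemma leg_of_connected: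
  assumes "K \<subseteq> X" "connected K" "v \<notin> K" "c \<in> I" "a \<in> {0..1}" "lam c a \<in> K"
  shows "K \<subseteq> lam c ` {0..1}"
proof -
  have "K \<noteq> {}" using assms(6) by auto
  then obtain d where d: "d \<in> I" "K \<subseteq> lam d ` {0..1}" using one_leg[OF assms(1-3)] by blast
  then obtain t where "t \<in> {0..1}" "lam c a = lam d t" using assms(6) by blast
  then have "a = 0 \<or> c = d" using inj[of c d a t] assms d by blast
  moreover have "a \<noteq> 0" using assms by auto
  ultimately show ?thesis using d by simp
qed

text \<open>\<open>K\<close> lies in one leg, and the inverse of that leg turns it into an interval
  of parameters.\<close>

lemma between_off_v:
  assumes "K \<subseteq> X" "connected K" "v \<notin> K" "c \<in> I" "lam c a \<in> K" "lam c b \<in> K"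
    and "0 \<le> a" "a \<le> s" "s \<le> b" "b \<le> 1"
  shows "lam c s \<in> K"
proof -
  have sub: "K \<subseteq> lam c ` {0..1}" using leg_of_connected[of K c a] assms by auto
  obtain k where k: "continuous_on (lam c ` {0..1}) k" "\<And>s. s \<in> {0..1} \<Longrightarrow> k (lam c s) = s"
    using leg_inverse[OF assms(4)] by blast
  have "connected (k ` K)"
    using assms(2) k(1) sub continuous_on_subset connected_continuous_image by blast
  moreover have "a \<in> k ` K" "b \<in> k ` K"
    using imageI[OF assms(5), of k] imageI[OF assms(6), of k] k(2)[of a] k(2)[of b] assms(7-10) by simp_all
  ultimately have "s \<in> k ` K" using assms connectedD_interval by blast
  then obtain p where p: "p \<in> K" "s = k p" by blast
  then obtain r where "r \<in> {0..1}" "p = lam c r" using sub by blast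
  then show ?thesis using p k(2)[of r] by simp
qed

text \<open>By boundary bumping, the component of \<open>lam c b\<close> in \<open>K - {v}\<close>
  accumulates at \<open>v\<close>. It stays in the leg of \<open>c\<close>, so it contains a point
  with parameter below \<open>s\<close> and then, being connected, also
  \<open>lam c s\<close>.\<close>

lemma downward_closed:
  assumes "K \<subseteq> X" "connected K" "compact K" "v \<in> K" "c \<in> I" "lam c b \<in> K"
    and "0 \<le> s" "s \<le> b" "b \<le> 1"
  shows "lam c s \<in> K"
proof (cases "s = 0")
  case True then show ?thesis using assms by simp
next
  case False
  then have s: "0 < s" using assms by simp
  let ?T = "top_of_set K" and ?S = "K - {v}"
  have p: "lam c b \<in> ?S" using assms s eq_v_iff[of c b] by auto
  define Z where "Z = connected_component_of_set (subtopology ?T ?S) (lam c b)"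
  have sub: "subtopology ?T ?S = top_of_set ?S"
    by (simp add: subtopology_subtopology Int_absorb1)
  have Zc: "Z \<in> connected_components_of (subtopology ?T ?S)"
    using p by (auto simp: Z_def connected_components_of_def sub)
  have pZ: "lam c b \<in> Z" using p by (simp add: Z_def sub connected_component_of_refl)
  have Zconn: "connected Z" "Z \<subseteq> ?S"
    using connectedin_connected_components_of[OF Zc] unfolding sub
    by (auto simp: connectedin_subtopology)
  have fr: "?T frontier_of Z \<inter> ?T frontier_of ?S \<noteq> {}"
  proof (rule boundary_bumping_theorem[OF _ _ _ _ Zc])
    show "connected_space ?T" using \<open>connected K\<close> connectedin_def[of euclidean K] by simp
    show "compact_space ?T" using \<open>compact K\<close> compact_space_subtopology[of euclidean K] by simp
    show "Hausdorff_space ?T" using Hausdorff_space_subtopology[of euclidean K] by simp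
    show "?S \<subset> topspace ?T" using assms by auto
  qed
  \<comment> \<open>\<open>K - {v}\<close> is open in \<open>K\<close>, so \<open>v\<close> is its
    only possible frontier point, and boundary bumping must deliver this point.\<close>
  have "openin ?T ?S" by (auto simp: openin_open intro!: exI[of _ "- {v}"])
  then have "?T frontier_of ?S \<subseteq> {v}"
    by (auto simp: frontier_of_def interior_of_openin closure_of_def)
  then have vcl: "v \<in> ?T closure_of Z" using fr by (auto simp: frontier_of_def)
  have ZX: "Z \<subseteq> X" "v \<notin> Z" using Zconn assms by auto
  \<comment> \<open>Otherwise \<open>Z\<close> would lie in the image of \<open>{s..1}\<close>, a
    compact set without \<open>v\<close>.\<close>
  have "\<exists>a\<in>{0..1}. a < s \<and> lam c a \<in> Z"
  proof (rule ccontr)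
    assume neg: "\<not> ?thesis"
    have "Z \<subseteq> lam c ` {0..1}" using leg_of_connected[of Z c b] ZX Zconn pZ assms by auto
    then have Z1: "Z \<subseteq> lam c ` {s..1}" using neg by fastforce
    have "closed (lam c ` {s..1})"
      using s assms by (intro compact_imp_closed compact_continuous_image cont_sub) auto
    then have "?T closure_of Z \<subseteq> lam c ` {s..1}"
      using Z1 by (metis closed_closedin closure_of_minimal closure_of_subtopology_subset order_trans)
    then obtain r where "r \<in> {s..1}" "lam c r = v" using vcl by auto
    then show False using eq_v_iff[of c r] assms s by auto
  qed
  then obtain a where "a \<in> {0..1}" "a < s" "lam c a \<in> Z" by blast
  then have "lam c s \<in> Z" using between_off_v[of Z c a b s] ZX Zconn pZ assms by auto
  then show ?thesis using Zconn by blast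
qed

lemma between:
  assumes "K \<subseteq> X" "connected K" "compact K" "c \<in> I" "lam c a \<in> K" "lam c b \<in> K"
    and "0 \<le> a" "a \<le> s" "s \<le> b" "b \<le> 1"
  shows "lam c s \<in> K"
  using downward_closed[of K c b s] between_off_v[of K c a b s] assms by (cases "v \<in> K") auto

text \<open>If both sets contain \<open>v\<close>, they are closed downwards, and the intersection
  is a union of initial segments of legs through \<open>v\<close>. If one of them misses
  \<open>v\<close>, it lies in a single leg, and the intersection is the image of an interval. This
  gives unicoherence of all subcontinua at once.\<close>

lemma connected_Int:
  assumes "S \<subseteq> X" "connected S" "compact S" "T \<subseteq> X" "connected T" "compact T"
  shows "connected (S \<inter> T)"
proof (cases "v \<in> S \<inter> T")
  case True
  let ?F = "{lam c ` {0..s} | c s. c \<in> I \<and> s \<in> {0..1} \<and> lam c s \<in> S \<inter> T}"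
  have sub: "lam c ` {0..s} \<subseteq> S \<inter> T" if "c \<in> I" "s \<in> {0..1}" "lam c s \<in> S \<inter> T" for c s
    using downward_closed[of S c s] downward_closed[of T c s] assms True that by auto
  have "S \<inter> T = \<Union>?F"
  proof
    show "S \<inter> T \<subseteq> \<Union>?F"
    proof
      fix x assume x: "x \<in> S \<inter> T"
      then obtain c s where "c \<in> I" "s \<in> {0..1}" "x = lam c s" using assms X_cases by blast
      then show "x \<in> \<Union>?F" using x by (intro UnionI[of "lam c ` {0..s}"]) auto
    qed
    show "\<Union>?F \<subseteq> S \<inter> T" using sub by blast
  qed
  moreover have "connected (\<Union>?F)"
  proof (rule connected_Union)
    show "connected A" if "A \<in> ?F" for A
      using that by (auto intro!: connected_continuous_image cont_sub)
    have "v \<in> A" if "A \<in> ?F" for A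
      using that base by (auto intro!: image_eqI[of v _ 0] simp del: base)
    then show "\<Inter>?F \<noteq> {}" by blast
  qed
  ultimately show ?thesis by argo
next
  case False
  \<comment> \<open>Only the first set has to miss \<open>v\<close>; the other case follows by
    symmetry.\<close>
  have key: "connected (S \<inter> T)" if S: "S \<subseteq> X" "connected S" "compact S"
    and T: "T \<subseteq> X" "connected T" "compact T" and nv: "v \<notin> S" for S T
  proof (cases "S = {}")
    case False
    then obtain c where c: "c \<in> I" "S \<subseteq> lam c ` {0..1}" using one_leg S nv by blast
    let ?J = "{s \<in> {0..1}. lam c s \<in> S \<inter> T}"
    have "connected ?J"
      unfolding connected_iff_interval
    proof (intro ballI allI impI)
      fix a b s assume "a \<in> ?J" "b \<in> ?J" "a \<le> s" "s \<le> b"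
      then show "s \<in> ?J" using between[OF S c(1), of a b s] between[OF T c(1), of a b s] by simp
    qed
    moreover have "S \<inter> T = lam c ` ?J" using c(2) by blast
    moreover have "continuous_on ?J (lam c)" using c(1) by (rule cont_sub) auto
    ultimately show ?thesis using connected_continuous_image by metis
  qed simp
  show ?thesis using False key[of S T] key[of T S] assms by (auto simp: Int_commute)
qed

section \<open>Hedgehogs are dendroids\<close>

lemma connected_X: "connected X"
  unfolding cover
proof (rule connected_Union)
  show "connected A" if "A \<in> (\<lambda>c. lam c ` {0..1}) ` I" for A
    using that by (auto intro!: connected_continuous_image cont)
  have "v \<in> A" if "A \<in> (\<lambda>c. lam c ` {0..1}) ` I" for A
    using that base by (auto intro!: image_eqI[of v _ 0] simp del: base)
  then show "\<Inter>((\<lambda>c. lam c ` {0..1}) ` I) \<noteq> {}" by blast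
qed

lemma hereditarily_unicoherent_X: "hereditarily_unicoherent X"
  unfolding hereditarily_unicoherent_def continuum_def
proof (intro allI impI)
  fix Y assume Y: "Y \<subseteq> X \<and> Y \<noteq> {} \<and> compact Y \<and> connected Y"
  show "unicoherent Y"
  proof
    fix S T assume ST: "connected S" "connected T" "Y = S \<union> T"
      "closedin (top_of_set Y) S" "closedin (top_of_set Y) T"
    then have "compact S" "compact T" using Y closedin_compact by blast+
    then show "connected (S \<inter> T)" using connected_Int ST Y by auto
  qed
qed

lemma arc_leg:
  assumes "c \<in> I" "a \<in> {0..1}" "b \<in> {0..1}" "a \<noteq> b"
  shows "arc_with_ends (lam c a) (lam c b) (lam c ` closed_segment a b)"
proof -
  have seg: "linepath a b ` {0..1} = closed_segment a b"
    using path_image_linepath by (simp add: path_image_def)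
  have sub: "closed_segment a b \<subseteq> {0..1}"
    using assms by (intro closed_segment_subset) auto
  have "arc (linepath a b)" using assms by (simp add: arc_linepath)
  then have "continuous_on {0..1} (linepath a b)" "inj_on (linepath a b) {0..1}"
    by (auto simp: arc_def path_def)
  note lp = this
  have "continuous_on {0..1} (lam c \<circ> linepath a b)"
    using lp(1) cont_sub[OF assms(1) sub] seg by (intro continuous_on_compose) simp_all
  moreover have "inj_on (lam c \<circ> linepath a b) {0..1}"
    using lp(2) inj_on_subset[OF inj_leg[OF assms(1)] sub] seg by (intro comp_inj_on) simp_all
  ultimately have "arc (lam c \<circ> linepath a b)" by (simp add: arc_def path_def)
  moreover have "path_image (lam c \<circ> linepath a b) = lam c ` closed_segment a b"
    unfolding path_image_def image_comp[symmetric] seg ..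
  moreover have "pathstart (lam c \<circ> linepath a b) = lam c a" "pathfinish (lam c \<circ> linepath a b) = lam c b"
    by (simp_all add: pathstart_def pathfinish_def linepath_def)
  ultimately show ?thesis unfolding arc_with_ends_def by blast
qed

lemma arc_with_ends_trans:
  assumes "arc_with_ends x y A" "arc_with_ends y z B" "A \<inter> B \<subseteq> {y}"
  shows "arc_with_ends x z (A \<union> B)"
proof -
  obtain f g where "arc f" "path_image f = A" "pathstart f = x" "pathfinish f = y"
    "arc g" "path_image g = B" "pathstart g = y" "pathfinish g = z"
    using assms by (auto simp: arc_with_ends_def)
  then show ?thesis unfolding arc_with_ends_def using assms(3)
    by (intro exI[of _ "f +++ g"]) (auto simp: path_image_join intro!: arc_join)
qed

lemma arcwise_connected_X: "arcwise_connected X"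
  unfolding arcwise_connected_def
proof (intro ballI impI)
  fix x y assume "x \<in> X" "y \<in> X" and ne: "x \<noteq> y"
  then obtain c s d t where c: "c \<in> I" "s \<in> {0..1}" "x = lam c s" and d: "d \<in> I" "t \<in> {0..1}" "y = lam d t"
    using X_cases by metis
  have leg: "lam e ` closed_segment a b \<subseteq> X" if "e \<in> I" "a \<in> {0..1}" "b \<in> {0..1}" for e a b
    using that in_X closed_segment_subset[of a "{0..1}" b] by auto
  \<comment> \<open>In the first three cases one leg contains both points; in the last one the arc
    passes through \<open>v\<close>.\<close>
  consider "s = 0" | "t = 0" | "c = d" | "s \<noteq> 0" "t \<noteq> 0" "c \<noteq> d" by blast
  then show "\<exists>A\<subseteq>X. arc_with_ends x y A"
  proof cases
    case 1
    then have "arc_with_ends x y (lam d ` closed_segment 0 t)"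
      using arc_leg[of d 0 t] ne c d by force
    then show ?thesis using leg[of d 0 t] d by auto
  next
    case 2
    then have "arc_with_ends x y (lam c ` closed_segment s 0)"
      using arc_leg[of c s 0] ne c d by force
    then show ?thesis using leg[of c s 0] c by auto
  next
    case 3
    then have "arc_with_ends x y (lam c ` closed_segment s t)"
      using arc_leg[of c s t] ne c d by force
    then show ?thesis using leg[of c s t] c d by auto
  next
    case 4
    have a: "arc_with_ends x v (lam c ` closed_segment s 0)" "arc_with_ends v y (lam d ` closed_segment 0 t)"
      using arc_leg[of c s 0] arc_leg[of d 0 t] 4 c d by auto
    have sub: "closed_segment s 0 \<subseteq> {0..1}" "closed_segment 0 t \<subseteq> {0..1}"
      using c d by (intro closed_segment_subset; simp)+
    have "lam c ` closed_segment s 0 \<inter> lam d ` closed_segment 0 t \<subseteq> {v}"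
    proof
      fix p assume p: "p \<in> lam c ` closed_segment s 0 \<inter> lam d ` closed_segment 0 t"
      obtain q where q: "q \<in> {0..1}" "p = lam c q" using p sub by blast
      obtain r where r: "r \<in> {0..1}" "p = lam d r" using p sub by blast
      have "q = 0" using inj[of c d q r] 4 c(1) d(1) q r by metis
      then show "p \<in> {v}" using q(2) base[OF c(1)] by simp
    qed
    then have "arc_with_ends x y (lam c ` closed_segment s 0 \<union> lam d ` closed_segment 0 t)"
      using a arc_with_ends_trans by blast
    then show ?thesis using leg[of c s 0] leg[of d 0 t] c d
      by (intro exI[of _ "lam c ` closed_segment s 0 \<union> lam d ` closed_segment 0 t"] conjI Un_least) simp_all
  qed
qed

lemma dendroid_X: "dendroid X"
  using compact_space connected_X v_in_X arcwise_connected_X hereditarily_unicoherent_X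
  by (auto simp: dendroid_def continuum_def)

section \<open>Uniqueness of arcs from the top\<close>

lemma arc_minimal:
  assumes "arc_with_ends x y A" "B \<subseteq> A" "connected B" "x \<in> B" "y \<in> B"
  shows "B = A"
proof -
  obtain g where g: "arc g" "path_image g = A" "pathstart g = x" "pathfinish g = y"
    using assms(1) by (auto simp: arc_with_ends_def)
  obtain k where k: "homeomorphism {0..1} A g k"
    using homeomorphism_arc[OF g(1)] g(2) by blast
  have ck: "continuous_on B k"
    using k assms(2) continuous_on_subset unfolding homeomorphism_def by metis
  have gk: "g (k p) = p" if "p \<in> A" for p using homeomorphism_apply2[OF k that] .
  have kg: "k (g s) = s" if "s \<in> {0..1}" for s using homeomorphism_apply1[OF k that] .
  have "k x = 0" "k y = 1"
    using kg[of 0] kg[of 1] g(3,4) by (simp_all add: pathstart_def pathfinish_def)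
  then have "0 \<in> k ` B" "1 \<in> k ` B" using assms(4,5) by (metis image_eqI)+
  \<comment> \<open>The pulled-back set is connected and contains both ends of the unit
    interval.\<close>
  then have sub: "{0..1} \<subseteq> k ` B"
    using connected_continuous_image[OF ck assms(3)] connected_contains_Icc by blast
  have "p \<in> B" if "p \<in> A" for p
  proof -
    have "k p \<in> {0..1}" using k that by (auto simp: homeomorphism_def)
    then obtain q where "q \<in> B" "k p = k q" using sub by blast
    then show ?thesis using gk[of p] gk[of q] that assms(2) by (metis subsetD)
  qed
  then show ?thesis using assms(2) by blast
qed

text \<open>The initial segment lies in \<open>A\<close> because \<open>A\<close> is closed
  downwards, and an arc has no proper connected subset that joins its ends.\<close>

lemma arc_from_v:
  assumes "c \<in> I" "s \<in> {0..1}" "A \<subseteq> X" "arc_with_ends v (lam c s) A"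
  shows "A = lam c ` {0..s}"
proof -
  obtain g where g: "arc g" "path_image g = A" "pathstart g = v" "pathfinish g = lam c s"
    using assms(4) by (auto simp: arc_with_ends_def)
  then have "connected A" "compact A" "v \<in> A" "lam c s \<in> A"
    using connected_arc_image compact_arc_image pathstart_in_path_image pathfinish_in_path_image by metis+
  then have "lam c ` {0..s} \<subseteq> A" using downward_closed[of A c s] assms by auto
  moreover have "connected (lam c ` {0..s})"
    using assms by (intro connected_continuous_image cont_sub) auto
  moreover have "v \<in> lam c ` {0..s}" using assms by (intro image_eqI[of v "lam c" 0]) auto
  moreover have "lam c s \<in> lam c ` {0..s}" using assms by simp
  ultimately show ?thesis using arc_minimal[OF assms(4)] by metis
qed

text \<open>This form settles both the \<open>THE\<close> in \<open>arc_in\<close> and the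
  existential quantifier in \<open>below\<close>. The conjunct \<open>s \<noteq> 0\<close> reflects
  that the ends of an arc are distinct.\<close>

lemma arc_from_v_iff:
  assumes "c \<in> I" "s \<in> {0..1}"
  shows "A \<subseteq> X \<and> arc_with_ends v (lam c s) A \<longleftrightarrow> s \<noteq> 0 \<and> A = lam c ` {0..s}"
proof
  assume A: "A \<subseteq> X \<and> arc_with_ends v (lam c s) A"
  then obtain g where "arc g" "pathstart g = v" "pathfinish g = lam c s"
    by (auto simp: arc_with_ends_def)
  then have "lam c s \<noteq> v" using arc_distinct_ends[of g] by simp
  then have "s \<noteq> 0" using base[OF assms(1)] by metis
  then show "s \<noteq> 0 \<and> A = lam c ` {0..s}" using arc_from_v[OF assms] A by simp
next
  assume "s \<noteq> 0 \<and> A = lam c ` {0..s}"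
  then show "A \<subseteq> X \<and> arc_with_ends v (lam c s) A"
    using arc_leg[of c 0 s] assms in_X[OF assms(1)]
    by (simp add: closed_segment_eq_real_ivl image_subset_iff)
qed

lemma arc_in_v:
  assumes "c \<in> I" "s \<in> {0..1}"
  shows "arc_in X v (lam c s) = lam c ` {0..s}"
proof (cases "s = 0")
  case False
  then have "v \<noteq> lam c s" using eq_v_iff assms by metis
  then show ?thesis using assms False by (simp add: arc_in_def arc_from_v_iff)
qed (use assms in \<open>simp add: arc_in_def\<close>)

end

section \<open>Ramification points of a hedgehog\<close>

lemma arms_meet_above:
  fixes f g :: "real \<Rightarrow> real"
  assumes "continuous_on {0..r} f" "continuous_on {0..r} g" "0 \<le> r"
    and "f 0 = g 0" "f 0 < f r" "f 0 < g r"
  obtains s t where "s \<in> {0<..r}" "t \<in> {0<..r}" "f s = g t"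
proof -
  let ?w = "min (f r) (g r)"
  obtain s where s: "0 \<le> s" "s \<le> r" "f s = ?w" using IVT'[of f 0 ?w r] assms by auto
  obtain t where t: "0 \<le> t" "t \<le> r" "g t = ?w" using IVT'[of g 0 ?w r] assms by auto
  have "s \<noteq> 0" "t \<noteq> 0" using s t assms by (auto simp: min_def split: if_splits)
  then show thesis using that[of s t] s t by auto
qed

text \<open>The positive product says that both arms end on the same side of their common start. By
  the intermediate value theorem both then pass through the level of the nearer end.\<close>

lemma arms_meet:
  fixes f g :: "real \<Rightarrow> real"
  assumes "continuous_on {0..r} f" "continuous_on {0..r} g" "0 \<le> r"
    and "f 0 = g 0" "0 < (f r - f 0) * (g r - f 0)"
  obtains s t where "s \<in> {0<..r}" "t \<in> {0<..r}" "f s = g t"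
proof (cases "f 0 < f r")
  case True
  then show thesis using arms_meet_above[of r f g] assms that by (auto simp: zero_less_mult_iff)
next
  case False
  then have "f r < f 0" "g r < f 0" using assms by (auto simp: zero_less_mult_iff)
  then show thesis
    using arms_meet_above[of r "\<lambda>x. - f x" "\<lambda>x. - g x"] assms that
    by (auto intro!: continuous_on_minus)
qed

text \<open>Three arms leave the centre into two sides, so two of them go the same way and meet
  again. The size \<open>r\<close> is free because a given triod will be shrunk.\<close>

lemma no_triod_in_line:
  fixes m :: "real \<times> real \<Rightarrow> real"
  assumes r: "0 < r" and cont: "continuous_on ({-r..r} \<times> {0} \<union> {0} \<times> {0..r}) m"
    and inj: "inj_on m ({-r..r} \<times> {0} \<union> {0} \<times> {0..r})"
  shows False
proof -
  let ?S = "{-r..r} \<times> {0} \<union> {0} \<times> {0..r}"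
  define f1 f2 f3 where f: "f1 = (\<lambda>u. m (u, 0))" "f2 = (\<lambda>u. m (-u, 0))" "f3 = (\<lambda>u. m (0, u))"
  have c: "continuous_on {0..r} f1" "continuous_on {0..r} f2" "continuous_on {0..r} f3"
    unfolding f using r by (auto intro!: continuous_on_compose2[OF cont] continuous_intros)
  have eq: "f1 0 = f2 0" "f1 0 = f3 0" by (auto simp: f)
  have ne: "f1 r \<noteq> f1 0" "f2 r \<noteq> f1 0" "f3 r \<noteq> f1 0"
    using r inj_onD[OF inj, of "(r, 0)" "(0, 0)"] inj_onD[OF inj, of "(-r, 0)" "(0, 0)"]
      inj_onD[OF inj, of "(0, r)" "(0, 0)"] by (auto simp: f)
  have dj: "f1 s \<noteq> f2 t" "f1 s \<noteq> f3 t" "f2 s \<noteq> f3 t" if "s \<in> {0<..r}" "t \<in> {0<..r}" for s t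
    using that r inj_onD[OF inj, of "(s, 0)" "(-t, 0)"] inj_onD[OF inj, of "(s, 0)" "(0, t)"]
      inj_onD[OF inj, of "(-s, 0)" "(0, t)"] by (auto simp: f)
  consider "0 < (f1 r - f1 0) * (f2 r - f1 0)" | "0 < (f1 r - f1 0) * (f3 r - f1 0)"
    | "0 < (f2 r - f1 0) * (f3 r - f1 0)"
    using ne by (auto simp: zero_less_mult_iff) linarith+
  then show False
    using arms_meet[OF c(1,2)] arms_meet[OF c(1,3)] arms_meet[OF c(2,3)] eq dj r
    by cases (metis less_imp_le)+
qed

lemma compact_standard_triod: "compact standard_triod"
  unfolding standard_triod_def by (intro compact_Un compact_Times) auto

context hedgehog
begin

lemma ramification_v: "ramification_point X v"
proof -
  obtain c d e where I: "c \<in> I" "d \<in> I" "e \<in> I" and ne: "c \<noteq> d" "c \<noteq> e" "d \<noteq> e"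
    using three_legs by blast
  \<comment> \<open>The three arms are sent to three legs; at the origin all three formulas give
    \<open>v\<close>.\<close>
  define h where "h = (\<lambda>(a::real, b::real). if 0 < b then lam e b else if 0 \<le> a then lam c a else lam d (- a))"
  let ?P = "{0..1} \<times> {0::real}" and ?M = "{-1..0} \<times> {0::real}" and ?N = "{0::real} \<times> {0..1::real}"
  have tri: "standard_triod = ?P \<union> ?M \<union> ?N"
    by (auto simp: standard_triod_def)
  have "continuous_on ?P (\<lambda>p. lam c (fst p))" "continuous_on ?M (\<lambda>p. lam d (- fst p))"
    "continuous_on ?N (\<lambda>p. lam e (snd p))"
    using I by (auto intro!: continuous_on_compose2[OF cont] continuous_intros)
  moreover have "lam c (fst p) = h p" if "p \<in> ?P" for p using that by (auto simp: h_def)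
  moreover have "lam d (- fst p) = h p" if "p \<in> ?M" for p using that I by (auto simp: h_def)
  moreover have "lam e (snd p) = h p" if "p \<in> ?N" for p using that I by (auto simp: h_def)
  ultimately have "continuous_on ?P h" "continuous_on ?M h" "continuous_on ?N h"
    by (simp_all cong: continuous_on_cong)
  then have ch: "continuous_on standard_triod h"
    unfolding tri by (intro continuous_on_closed_Un closed_Un closed_Times) auto
  have ih: "inj_on h standard_triod"
  proof (rule inj_onI)
    fix p q assume p: "p \<in> standard_triod" and q: "q \<in> standard_triod" and eq: "h p = h q"
    \<comment> \<open>The leg names the arm and its parameter the position on it, so that
      \<open>inj\<close> yields injectivity of \<open>h\<close>.\<close>
    have leg: "\<exists>i\<in>I. \<exists>s\<in>{0..1}. h p = lam i s \<and> (i = e \<longrightarrow> p = (0, s)) \<and> (i = c \<longrightarrow> p = (s, 0)) \<and> (i = d \<longrightarrow> p = (-s, 0)) \<and> (i = c \<or> i = d \<or> i = e)"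
      if "p \<in> standard_triod" for p
    proof -
      obtain a b where [simp]: "p = (a, b)" by force
      have "b = 0 \<and> -1 \<le> a \<and> a \<le> 1 \<or> a = 0 \<and> 0 \<le> b \<and> b \<le> 1"
        using that by (auto simp: standard_triod_def)
      then consider "0 < b" "a = 0" "b \<le> 1" | "b = 0" "0 \<le> a" "a \<le> 1" | "b = 0" "a < 0" "-1 \<le> a"
        by linarith
      then show ?thesis
      proof cases
        case 1 then show ?thesis using I ne by (intro bexI[of _ e] bexI[of _ b]) (auto simp: h_def)
      next
        case 2 then show ?thesis using I ne by (intro bexI[of _ c] bexI[of _ a]) (auto simp: h_def)
      next
        case 3 then show ?thesis using I ne by (intro bexI[of _ d] bexI[of _ "-a"]) (auto simp: h_def)
      qed
    qed
    obtain i s where i: "i \<in> I" "s \<in> {0..1}" "h p = lam i s" "i = e \<longrightarrow> p = (0, s)"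
       "i = c \<longrightarrow> p = (s, 0)" "i = d \<longrightarrow> p = (-s, 0)" "i = c \<or> i = d \<or> i = e"
      using leg[OF p] by blast
    obtain j t where j: "j \<in> I" "t \<in> {0..1}" "h q = lam j t" "j = e \<longrightarrow> q = (0, t)"
       "j = c \<longrightarrow> q = (t, 0)" "j = d \<longrightarrow> q = (-t, 0)" "j = c \<or> j = d \<or> j = e"
      using leg[OF q] by blast
    have "s = t \<and> (s = 0 \<or> i = j)" by (rule inj[OF i(1) j(1) i(2) j(2)]) (metis eq i(3) j(3))
    then show "p = q" using i(4-7) j(4-7) by auto
  qed
  obtain k where "homeomorphism standard_triod (h ` standard_triod) h k"
    using homeomorphism_compact[OF compact_standard_triod ch refl ih] by blast
  moreover have "h (0, 0) = v" using I by (simp add: h_def)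
  moreover have "h ` standard_triod \<subseteq> X" using I in_X v_in_X by (auto simp: h_def standard_triod_def)
  ultimately show ?thesis unfolding ramification_point_def triod_with_top_def by blast
qed

text \<open>At most one point of the triod is mapped to \<open>v\<close>, and it is not the centre.
  So a smaller triod around the centre misses \<open>v\<close>, lies in one leg and would embed in
  the line.\<close>

lemma ramification_only_v:
  assumes "ramification_point X x"
  shows "x = v"
proof (rule ccontr)
  assume xv: "x \<noteq> v"
  obtain T h k where T: "T \<subseteq> X" and hk: "homeomorphism standard_triod T h k" and top: "h (0, 0) = x"
    using assms by (auto simp: ramification_point_def triod_with_top_def)
  have ch: "continuous_on standard_triod h" and ih: "inj_on h standard_triod" and im: "h ` standard_triod = T"
    using hk unfolding homeomorphism_def by (blast, metis inj_on_def, blast)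
  define S where "S = (\<lambda>r::real. {-r..r} \<times> {0::real} \<union> {0::real} \<times> {0..r})"
  have Sst: "S r \<subseteq> standard_triod" if "r \<le> 1" for r
    using that by (auto simp: S_def standard_triod_def)
  have "\<exists>r. 0 < r \<and> r \<le> 1 \<and> v \<notin> h ` S r"
  proof (cases "v \<in> h ` standard_triod")
    case True
    then obtain a b where ab: "(a, b) \<in> standard_triod" "h (a, b) = v" by force
    have nz: "a \<noteq> 0 \<or> b \<noteq> 0" using ab top xv by auto
    have b: "\<bar>a\<bar> \<le> 1" "0 \<le> b" "b \<le> 1" "a = 0 \<or> b = 0" using ab by (auto simp: standard_triod_def)
    \<comment> \<open>Half the distance of the bad point from the centre, since \<open>a\<close> or
      \<open>b\<close> is zero.\<close>
    let ?r = "(\<bar>a\<bar> + b) / 2"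
    have "(a, b) \<notin> S ?r" using nz b by (auto simp: S_def)
    have r: "0 < ?r" "?r \<le> 1" using nz b by auto
    have "v \<notin> h ` S ?r"
    proof
      assume "v \<in> h ` S ?r"
      then obtain q where q: "q \<in> S ?r" "h q = v" by blast
      then have "q = (a, b)" using inj_onD[OF ih, of q "(a, b)"] ab Sst[OF r(2)] by auto
      then show False using q \<open>(a, b) \<notin> S ?r\<close> by simp
    qed
    then show ?thesis using r by blast
  next
    case False
    then show ?thesis using Sst[of 1] by (intro exI[of _ 1]) auto
  qed
  then obtain r where r: "0 < r" "r \<le> 1" "v \<notin> h ` S r" by blast
  have cS: "continuous_on (S r) h" using ch Sst[OF r(2)] continuous_on_subset by blast
  have "(0, 0) \<in> {-r..r} \<times> {0::real} \<inter> {0::real} \<times> {0..r}" using r by simp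
  then have "{-r..r} \<times> {0::real} \<inter> {0::real} \<times> {0..r} \<noteq> {}" by blast
  then have "connected (S r)" unfolding S_def
    by (intro connected_Un connected_Times) simp_all
  then have conn: "connected (h ` S r)" using cS connected_continuous_image by blast
  have "(0, 0) \<in> S r" using r by (simp add: S_def)
  then have "h ` S r \<noteq> {}" "h ` S r \<subseteq> X" using image_mono[OF Sst[OF r(2)], of h] im T by blast+
  then obtain c where c: "c \<in> I" "h ` S r \<subseteq> lam c ` {0..1}" using one_leg conn r by metis
  obtain m where m: "continuous_on (lam c ` {0..1}) m" "\<And>s. s \<in> {0..1} \<Longrightarrow> m (lam c s) = s"
    using leg_inverse[OF c(1)] by blast
  have "continuous_on (S r) (m \<circ> h)"
    using cS m(1) c(2) continuous_on_compose continuous_on_subset by metis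
  moreover have "inj_on m (lam c ` {0..1})" using m(2) by (auto simp: inj_on_def)
  then have "inj_on (m \<circ> h) (S r)"
    using c(2) ih Sst[OF r(2)] by (intro comp_inj_on) (auto intro: inj_on_subset)
  ultimately show False using no_triod_in_line[of r "m \<circ> h"] r unfolding S_def by blast
qed

lemma fan_X: "fan X"
  using dendroid_X ramification_only_v by (auto simp: fan_def)

lemma is_top_v: "is_top X v"
  using fan_X ramification_v by (simp add: is_top_def)

end

section \<open>Folding one leg of a fan over a Cantor set\<close>

text \<open>Letters of both signs tend to 0, which keeps the alphabet compact and lets words adjust
  heights finely; countability leaves gaps that separate codes.\<close>

definition alphabet :: "real set" where
  "alphabet = insert 0 (range (\<lambda>n. 1 / Suc n)) \<union> insert 0 (range (\<lambda>n. - 1 / Suc n))"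

lemma countable_alphabet: "countable alphabet"
  by (simp add: alphabet_def)

lemma zero_in_alphabet [simp]: "0 \<in> alphabet"
  by (simp add: alphabet_def)

lemma inverse_Suc_in_alphabet: "1 / Suc n \<in> alphabet" "- 1 / Suc n \<in> alphabet"
  unfolding alphabet_def by blast+

lemma compact_alphabet: "compact alphabet"
proof -
  have "(\<lambda>n. 1 / real (Suc n)) \<longlonglongrightarrow> 0" "(\<lambda>n. - 1 / real (Suc n)) \<longlonglongrightarrow> 0"
    using tendsto_minus[OF LIMSEQ_inverse_real_of_nat] LIMSEQ_inverse_real_of_nat
    by (simp_all add: inverse_eq_divide)
  then show ?thesis unfolding alphabet_def
    by (intro compact_Un compact_sequence_with_limit)
qed

definition codes :: "(int \<Rightarrow> real) set" where
  "codes = {c. \<forall>i. c i \<in> alphabet}"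

lemma codesD: "c \<in> codes \<Longrightarrow> c i \<in> alphabet"
  by (simp add: codes_def)

lemma zero_in_codes [simp]: "(\<lambda>_. 0) \<in> codes"
  by (simp add: codes_def)

lemma compact_codes: "compact codes"
proof -
  have "codes = PiE UNIV (\<lambda>_. alphabet)" by (auto simp: codes_def PiE_def)
  then show ?thesis
    using compactin_PiE[of "\<lambda>_::int. euclidean" UNIV "\<lambda>_. alphabet"] compact_alphabet
    by (simp add: euclidean_product_topology)
qed

text \<open>Both \<^term>\<open>t * c i\<close> and \<^term>\<open>t * (c i)\<^sup>2\<close> are recorded, so that \<^term>\<open>c i\<close> can be read off as their quotient.\<close>

definition fold_map :: "(real \<Rightarrow> real) \<Rightarrow> (int \<Rightarrow> real) \<Rightarrow> real \<Rightarrow> nat \<Rightarrow> real" where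
  "fold_map g c t n = (case n of 0 \<Rightarrow> g t | Suc m \<Rightarrow> t * c (int_decode (m div 2)) ^ Suc (m mod 2))"

lemma fold_map_0 [simp]: "fold_map g c t 0 = g t"
  by (simp add: fold_map_def)

lemma fold_map_1 [simp]: "fold_map g c t (Suc (2 * int_encode i)) = t * c i"
  by (simp add: fold_map_def)

lemma fold_map_2 [simp]: "fold_map g c t (Suc (2 * int_encode i + 1)) = t * (c i)\<^sup>2"
proof -
  have "(2 * int_encode i + 1) div 2 = int_encode i" "(2 * int_encode i + 1) mod 2 = 1" by presburger+
  then show ?thesis unfolding fold_map_def by (simp add: power2_eq_square del: One_nat_def)
qed

lemma fold_map_degenerate:
  assumes "c = (\<lambda>_. 0) \<or> t = 0"
  shows "fold_map g c t = (\<lambda>n. if n = 0 then g t else 0)"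
  using assms by (auto simp: fold_map_def fun_eq_iff split: nat.split)

text \<open>The two coordinates at some \<open>i\<close> with \<open>c i \<noteq> 0\<close> have the
  letter as their quotient, and this reveals the height. Coordinate 0 does not enter, so
  \<open>g\<close> and \<open>h\<close> may differ, as they do when the unfolded leg is compared
  with the others.\<close>

lemma fold_map_inj:
  assumes eq: "fold_map g c t = fold_map h d u" and t: "t \<noteq> 0" and c: "c \<noteq> (\<lambda>_. 0)"
  shows "t = u" "c = d"
proof -
  have 1: "t * c i = u * d i" for i using fun_cong[OF eq, of "Suc (2 * int_encode i)"] by simp
  have 2: "t * (c i)\<^sup>2 = u * (d i)\<^sup>2" for i
    using fun_cong[OF eq, of "Suc (2 * int_encode i + 1)"] unfolding fold_map_2 .
  obtain i where i: "c i \<noteq> 0" using c by auto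
  have "(t * c i) * c i = (t * c i) * d i"
    using 2[of i] 1[of i] by (metis mult.assoc power2_eq_square)
  then have "c i = d i" using i t by simp
  then show "t = u" using 1[of i] i by simp
  then show "c = d" using 1 t by auto
qed

lemma continuous_on_fold_map:
  assumes "continuous_on {0..1} g"
  shows "continuous_on (S \<times> {0..1}) (\<lambda>p. fold_map g (fst p) (snd p))"
proof (rule continuous_on_coordinatewise_then_product)
  have c: "continuous_on T (\<lambda>p. (fst p :: int \<Rightarrow> real) i)" for T :: "((int \<Rightarrow> real) \<times> real) set" and i
    using continuous_on_product_then_coordinatewise[OF continuous_on_fst[OF continuous_on_id]] .
  fix n
  show "continuous_on (S \<times> {0..1}) (\<lambda>p. fold_map g (fst p) (snd p) n)"
  proof (cases n)
    case 0
    have "continuous_on (S \<times> {0..1}) (\<lambda>p. g (snd p))"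
      by (rule continuous_on_compose2[OF assms]) (auto intro: continuous_intros)
    then show ?thesis using 0 by simp
  next
    case (Suc m)
    then show ?thesis unfolding fold_map_def nat.case
      by (simp only: nat.case) (intro continuous_on_mult continuous_on_power continuous_on_snd continuous_on_id c)
  qed
qed

text \<open>Between two distinct letters there is an \<open>r\<close> outside the countable
  alphabet, so coordinate \<open>i\<close> cuts the codes into two clopen parts.\<close>

lemma codes_separated:
  assumes "c \<in> codes" "d \<in> codes" "c \<noteq> d"
  obtains i r where "r \<notin> alphabet" "c i < r \<and> r < d i \<or> d i < r \<and> r < c i"
proof -
  have gap: "\<exists>r. r \<notin> alphabet \<and> a < r \<and> r < b" if "a < b" for a b :: real
  proof -
    have "uncountable {a<..<b}" using that by (simp add: uncountable_open_interval)
    then have "\<not> {a<..<b} \<subseteq> alphabet" using countable_alphabet countable_subset by blast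
    then show ?thesis by auto
  qed
  obtain i where "c i \<noteq> d i" using assms by auto
  then show thesis using gap[of "c i" "d i"] gap[of "d i" "c i"] that by (metis linorder_neqE)
qed

section \<open>The folded fan as a hedgehog\<close>

definition folded_fan :: "(real \<Rightarrow> real) \<Rightarrow> (nat \<Rightarrow> real) set" where
  "folded_fan g = (\<lambda>p. fold_map g (fst p) (snd p)) ` (codes \<times> {0..1})"

lemma folded_fan_cases:
  assumes "x \<in> folded_fan g"
  obtains c t where "c \<in> codes" "t \<in> {0..1}" "x = fold_map g c t"
  using assms by (auto simp: folded_fan_def)

lemma in_folded_fan: "c \<in> codes \<Longrightarrow> t \<in> {0..1} \<Longrightarrow> fold_map g c t \<in> folded_fan g"
  unfolding folded_fan_def by force

locale folding =
  fixes g :: "real \<Rightarrow> real"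
  assumes cont_g: "continuous_on {0..1} g"
    and g_0 [simp]: "g 0 = 0"
    and g_image: "g ` {0..1} = {0..1}"
begin

abbreviation Q where "Q \<equiv> fold_map g"
abbreviation "top_pt \<equiv> (\<lambda>_::nat. 0::real)"

text \<open>The leg of the zero code is parametrised by its height: \<open>Q\<close> runs through it
  along \<open>g\<close>, which need not be injective.\<close>

definition leg :: "(int \<Rightarrow> real) \<Rightarrow> real \<Rightarrow> nat \<Rightarrow> real" where
  "leg c = (if c = (\<lambda>_. 0) then fold_map (\<lambda>s. s) c else Q c)"

lemma leg_nonzero: "c \<noteq> (\<lambda>_. 0) \<Longrightarrow> leg c = Q c"
  by (simp add: leg_def)

lemma leg_zero: "leg (\<lambda>_. 0) s = (\<lambda>n. if n = 0 then s else 0)"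
  by (simp add: leg_def fold_map_degenerate)

lemma g_in: "t \<in> {0..1} \<Longrightarrow> g t \<in> {0..1}"
  using g_image by blast

lemma Q_zero: "Q (\<lambda>_. 0) t = leg (\<lambda>_. 0) (g t)"
  by (simp add: leg_zero fold_map_degenerate)

lemma Q_base: "Q c 0 = top_pt"
  by (simp add: fold_map_degenerate fun_eq_iff)

lemma leg_base: "leg c 0 = top_pt"
  by (simp add: leg_def fold_map_degenerate fun_eq_iff)

lemma Q_in_leg: "t \<in> {0..1} \<Longrightarrow> Q c t \<in> leg c ` {0..1}"
  using g_in[of t] by (cases "c = (\<lambda>_. 0)") (auto simp: Q_zero leg_nonzero)

lemma leg_in_Q: "s \<in> {0..1} \<Longrightarrow> leg c s \<in> Q c ` {0..1}"
proof (cases "c = (\<lambda>_. 0)")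
  case True
  assume "s \<in> {0..1}"
  then obtain t where "t \<in> {0..1}" "s = g t" using g_image by blast
  then show ?thesis using True Q_zero by auto
qed (auto simp: leg_nonzero)

lemma compact_Q: 
  assumes "compact S" "S \<subseteq> codes \<times> {0..1}"
  shows "compact ((\<lambda>p. Q (fst p) (snd p)) ` S)"
  by (rule compact_continuous_image[OF continuous_on_subset[OF continuous_on_fold_map[OF cont_g]] assms(1)])
     (use assms(2) in blast)

text \<open>Away from the top the code survives even on the folded leg, where the parameter may be
  lost.\<close>

lemma Q_code_unique:
  assumes "Q c t = Q d u" "Q c t \<noteq> top_pt"
  shows "c = d"
proof (cases "c = (\<lambda>_. 0) \<and> d = (\<lambda>_. 0)")
  case False
  have "t \<noteq> 0" "u \<noteq> 0" using assms Q_base by metis+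
  then show ?thesis using fold_map_inj(2)[OF assms(1)] fold_map_inj(2)[OF assms(1)[symmetric]] False
    by metis
qed simp

text \<open>Two different codes in \<open>K\<close> would be separated by a clopen cut of the codes.
  The images of the two halves are compact and can meet only in the top, so they would disconnect
  \<open>K\<close>.\<close>

lemma one_code:
  assumes K: "K \<subseteq> folded_fan g" "connected K" "top_pt \<notin> K"
    and c: "c \<in> codes" "t \<in> {0..1}" "Q c t \<in> K" and d: "d \<in> codes" "u \<in> {0..1}" "Q d u \<in> K"
  shows "c = d"
proof (rule ccontr)
  assume "c \<noteq> d"
  then obtain i r where r: "r \<notin> alphabet" "c i < r \<and> r < d i \<or> d i < r \<and> r < c i"
    using codes_separated c d by blast
  \<comment> \<open>Weak inequalities keep both halves closed; no code takes the value
    \<open>r\<close>, so they are disjoint within \<open>codes\<close>.\<close>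
  have cl: "closed {e::int \<Rightarrow> real. e i \<le> r}" "closed {e::int \<Rightarrow> real. r \<le> e i}"
    by (auto intro!: closed_Collect_le continuous_on_product_coordinates continuous_intros)
  define L where "L = (\<lambda>p. Q (fst p) (snd p)) ` ((codes \<inter> {e. e i \<le> r}) \<times> {0..1})"
  define R where "R = (\<lambda>p. Q (fst p) (snd p)) ` ((codes \<inter> {e. r \<le> e i}) \<times> {0..1})"
  have LR: "closed L" "closed R" unfolding L_def R_def
    using compact_codes cl by (auto intro!: compact_imp_closed compact_Q compact_Times compact_Int_closed)
  have "K \<subseteq> L \<union> R"
  proof
    fix x assume "x \<in> K"
    then obtain e s where "e \<in> codes" "s \<in> {0..1}" "x = Q e s" using K folded_fan_cases by blast
    then show "x \<in> L \<union> R" unfolding L_def R_def by (cases "e i \<le> r") force+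
  qed
  moreover have "L \<inter> R \<inter> K = {}"
  proof (rule ccontr)
    assume "L \<inter> R \<inter> K \<noteq> {}"
    then obtain x where x: "x \<in> L" "x \<in> R" "x \<in> K" by blast
    obtain e s where e: "e \<in> codes" "e i \<le> r" "x = Q e s" using x(1) unfolding L_def by auto
    obtain f s' where f: "f \<in> codes" "r \<le> f i" "x = Q f s'" using x(2) unfolding R_def by auto
    have "e = f" using Q_code_unique[of e s f s'] e f x K by metis
    then have "e i = r" using e f by simp
    then show False using e(1) r(1) codesD by metis
  qed
  moreover have "L \<inter> K \<noteq> {} \<and> R \<inter> K \<noteq> {}"
  proof -
    have "Q e s \<in> L" if "e \<in> codes" "e i < r" "s \<in> {0..1}" for e s
      using that unfolding L_def by force
    moreover have "Q e s \<in> R" if "e \<in> codes" "r < e i" "s \<in> {0..1}" for e s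
      using that unfolding R_def by force
    ultimately show ?thesis using c d r(2) by blast
  qed
  ultimately show False using connected_closedD[OF K(2), of L R] LR by blast
qed

sublocale hedgehog "folded_fan g" top_pt codes leg
proof
  show "compact (folded_fan g)" unfolding folded_fan_def
    using compact_Q[of "codes \<times> {0..1}"] compact_codes by (simp add: compact_Times)
  show "folded_fan g = (\<Union>c\<in>codes. leg c ` {0..1})"
  proof
    show "folded_fan g \<subseteq> (\<Union>c\<in>codes. leg c ` {0..1})"
    proof
      fix x assume "x \<in> folded_fan g"
      then show "x \<in> (\<Union>c\<in>codes. leg c ` {0..1})"
        by (rule folded_fan_cases) (use Q_in_leg in blast)
    qed
    show "(\<Union>c\<in>codes. leg c ` {0..1}) \<subseteq> folded_fan g"
    proof (intro UN_least subsetI)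
      fix c x assume c: "c \<in> codes" "x \<in> leg c ` {0..1}"
      then obtain t where "t \<in> {0..1}" "x = Q c t" using leg_in_Q by blast
      then show "x \<in> folded_fan g" using in_folded_fan c by simp
    qed
  qed
  show "continuous_on {0..1} (leg c)" for c
  proof -
    have *: "continuous_on {0..1} (fold_map h c)" if "continuous_on {0..1} h" for h
      using continuous_on_compose2[OF continuous_on_fold_map[OF that, of UNIV], of "{0..1}" "\<lambda>t. (c, t)"]
        continuous_on_Pair[OF continuous_on_const continuous_on_id, of "{0..1}" c] by auto
    show ?thesis unfolding leg_def using *[OF cont_g] * by auto
  qed
  show "leg c 0 = top_pt" for c by (rule leg_base)
  show "s = t \<and> (s = 0 \<or> c = d)" if "leg c s = leg d t" for c d s t
  proof (cases "c = (\<lambda>_. 0) \<and> d = (\<lambda>_. 0)")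
    case True
    then have "leg (\<lambda>_. 0) s 0 = leg (\<lambda>_. 0) t 0" using that by metis
    then show ?thesis using True unfolding leg_zero by simp
  next
    case False
    \<comment> \<open>\<open>G\<close> writes both kinds of legs as instances of
      \<open>fold_map\<close>, so that \<open>fold_map_inj\<close> applies to any pair of
      them.\<close>
    define G where "G = (\<lambda>e::int \<Rightarrow> real. if e = (\<lambda>_. 0) then (\<lambda>s. s) else g)"
    have G: "leg e = fold_map (G e) e" for e by (simp add: leg_def G_def)
    have z: "fold_map (G e) e 0 = top_pt" for e using leg_base[of e] G by simp
    have eq: "fold_map (G c) c s = fold_map (G d) d t" using that G by simp
    show ?thesis
    proof (cases "s = 0 \<and> t = 0")
      case nz: False
      have nondeg: "e \<noteq> (\<lambda>_. 0) \<and> a \<noteq> 0 \<Longrightarrow> fold_map (G e) e a \<noteq> fold_map h e' b"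
        if "e' = (\<lambda>_. 0) \<or> b = 0" for e a h e' b
        using that fold_map_inj[of "G e" e a h e' b] by metis
      have zz: "fold_map (G (\<lambda>_. 0)) (\<lambda>_. 0) a = (\<lambda>n. if n = 0 then a else 0)" for a
        by (simp add: G_def fold_map_degenerate)
      have A: "\<not> ((c = (\<lambda>_. 0) \<or> s = 0) \<and> d \<noteq> (\<lambda>_. 0) \<and> t \<noteq> 0)"
        using nondeg[of c s d t "G c"] eq by metis
      have B: "\<not> ((d = (\<lambda>_. 0) \<or> t = 0) \<and> c \<noteq> (\<lambda>_. 0) \<and> s \<noteq> 0)"
        using nondeg[of d t c s "G d"] eq by metis
      have C: "s = 0" if "c = (\<lambda>_. 0) \<and> t = 0"
      proof -
        have "fold_map (G (\<lambda>_. 0)) (\<lambda>_. 0) s = top_pt" using eq z that by metis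
        then show ?thesis unfolding zz by (metis (mono_tags))
      qed
      have D: "t = 0" if "d = (\<lambda>_. 0) \<and> s = 0"
      proof -
        have "fold_map (G (\<lambda>_. 0)) (\<lambda>_. 0) t = top_pt" using eq z that by metis
        then show ?thesis unfolding zz by (metis (mono_tags))
      qed
      have "s \<noteq> 0 \<and> t \<noteq> 0 \<and> c \<noteq> (\<lambda>_. 0)"
        using A B C D nz False by argo
      then show ?thesis using fold_map_inj[OF eq] by blast
    qed simp
  qed
  show "\<exists>c\<in>codes. K \<subseteq> leg c ` {0..1}" if "K \<subseteq> folded_fan g" "connected K" "top_pt \<notin> K" "K \<noteq> {}" for K
  proof -
    note K = that
    obtain x where x: "x \<in> K" using K by blast
    obtain c t where c: "c \<in> codes" "t \<in> {0..1}" "Q c t \<in> K"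
      using folded_fan_cases[of x g] x K(1) by blast
    have "y \<in> leg c ` {0..1}" if "y \<in> K" for y
    proof -
      obtain d u where d: "d \<in> codes" "u \<in> {0..1}" "y = Q d u"
        using folded_fan_cases[of y g] \<open>y \<in> K\<close> K(1) by blast
      then have "c = d" using one_code[OF K(1-3) c, of d u] \<open>y \<in> K\<close> by simp
      then show ?thesis using Q_in_leg d by blast
    qed
    then show ?thesis using c by blast
  qed
  \<comment> \<open>The constant codes 1 and -1, written in the form of the alphabet; the zero code
    is the third.\<close>
  let ?c = "\<lambda>_::int. 1 / real (Suc 0)" and ?d = "\<lambda>_::int. - 1 / real (Suc 0)"
  have "?c \<in> codes" "?d \<in> codes" unfolding codes_def using inverse_Suc_in_alphabet by blast+
  moreover have "?c \<noteq> ?d" "?c \<noteq> (\<lambda>_. 0)" "?d \<noteq> (\<lambda>_. 0)" by (auto simp: fun_eq_iff)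
  ultimately show "\<exists>c\<in>codes. \<exists>d\<in>codes. \<exists>e\<in>codes. c \<noteq> d \<and> c \<noteq> e \<and> d \<noteq> e"
    using zero_in_codes by blast
qed

end

section \<open>A transitive homeomorphism\<close>

text \<open>The preimage of a closed set under \<open>f\<close> is the \<open>q\<close>-image of its
  preimage under \<open>h\<close>, which is compact; hence it is closed in the Hausdorff
  target.\<close>

lemma descends_to_quotient:
  fixes q :: "'a::t2_space \<Rightarrow> 'b::t2_space" and h :: "'a \<Rightarrow> 'c::topological_space"
  assumes K: "compact K" and q: "continuous_on K q" and h: "continuous_on K h"
    and fib: "\<And>x y. x \<in> K \<Longrightarrow> y \<in> K \<Longrightarrow> q x = q y \<Longrightarrow> h x = h y"
  obtains f where "continuous_on (q ` K) f" "\<And>x. x \<in> K \<Longrightarrow> f (q x) = h x"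
proof -
  define f where "f = (\<lambda>y. h (SOME x. x \<in> K \<and> q x = y))"
  have f: "f (q x) = h x" if "x \<in> K" for x
  proof -
    have "(SOME x'. x' \<in> K \<and> q x' = q x) \<in> K \<and> q (SOME x'. x' \<in> K \<and> q x' = q x) = q x"
      by (rule someI[of "\<lambda>x'. x' \<in> K \<and> q x' = q x" x]) (use that in simp)
    then show ?thesis unfolding f_def using fib that by blast
  qed
  have "closed (q ` K)" using K q compact_continuous_image compact_imp_closed by blast
  moreover have "closed (f -` B \<inter> q ` K)" if "closed B" for B
  proof -
    have "f -` B \<inter> q ` K = q ` (h -` B \<inter> K)" using f by force
    moreover have "closed (h -` B \<inter> K)"
      using continuous_on_closed_vimage[OF compact_imp_closed[OF K]] h that by blast
    then have "compact (h -` B \<inter> K)" using closed_Int_compact[OF _ K] by (metis inf.right_idem)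
    then have "compact (q ` (h -` B \<inter> K))"
      using q by (intro compact_continuous_image) (auto intro: continuous_on_subset)
    ultimately show ?thesis by (simp add: compact_imp_closed)
  qed
  ultimately have "continuous_on (q ` K) f" by (simp add: continuous_on_closed_vimage)
  then show thesis using that f by blast
qed

text \<open>The flow of translations of the extended real line, transported to the unit interval by the logit function.\<close>

definition logit_flow :: "real \<Rightarrow> real \<Rightarrow> real" where
  "logit_flow t a = t * exp a / (1 - t + t * exp a)"

lemma logit_flow_denom: "t \<in> {0..1} \<Longrightarrow> 0 < 1 - t + t * exp a" for t :: real
  using add_nonneg_pos[of "1 - t" "t * exp a"] by (cases "t = 0") simp_all

lemma logit_flow_in: "t \<in> {0..1} \<Longrightarrow> logit_flow t a \<in> {0..1}"
  using logit_flow_denom[of t a] by (auto simp: logit_flow_def)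

lemma logit_flow_zero_time [simp]: "logit_flow t 0 = t"
  by (simp add: logit_flow_def)

lemma logit_flow_zero [simp]: "logit_flow 0 a = 0"
  by (simp add: logit_flow_def)

text \<open>The flow multiplies the odds \<open>t / (1 - t)\<close> by \<open>exp a\<close>.\<close>

lemma logit_flow_add:
  assumes "t \<in> {0..1}"
  shows "logit_flow (logit_flow t a) b = logit_flow t (a + b)"
proof -
  define D where "D = 1 - t + t * exp a"
  have D: "D \<noteq> 0" using logit_flow_denom[OF assms, of a] by (simp add: D_def)
  have l: "logit_flow t a = t * exp a / D" by (simp add: logit_flow_def D_def)
  have "1 - t * exp a / D + t * exp a / D * exp b = (D - t * exp a + t * exp a * exp b) / D"
    using D by (simp add: diff_divide_distrib add_divide_distrib)
  also have "D - t * exp a + t * exp a * exp b = 1 - t + t * exp (a + b)"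
    by (simp add: D_def exp_add)
  finally show ?thesis unfolding logit_flow_def[of "logit_flow t a"] l
    using D by (simp add: logit_flow_def exp_add)
qed

lemma logit_flow_transitive:
  assumes "0 < t" "t < 1" "0 < u" "u < 1"
  obtains a where "logit_flow t a = u"
proof
  \<comment> \<open>The logarithm of the ratio of the odds of \<open>u\<close> and
    \<open>t\<close>.\<close>
  let ?a = "ln (u * (1 - t) / (t * (1 - u)))"
  have e: "exp ?a = u * (1 - t) / (t * (1 - u))" using assms by simp
  have "t * exp ?a = u * (1 - t) / (1 - u)" unfolding e using assms by simp
  moreover have "1 - t + u * (1 - t) / (1 - u) = (1 - t) / (1 - u)"
    using assms by (simp add: field_simps)
  ultimately show "logit_flow t ?a = u" using assms by (simp add: logit_flow_def)
qed

lemma continuous_on_logit_flow: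
  fixes f h :: "'a::topological_space \<Rightarrow> real"
  assumes "continuous_on S f" "continuous_on S h" "\<And>x. x \<in> S \<Longrightarrow> f x \<in> {0..1}"
  shows "continuous_on S (\<lambda>x. logit_flow (f x) (h x))"
proof -
  have "1 - f x + f x * exp (h x) \<noteq> 0" if "x \<in> S" for x
    using logit_flow_denom[OF assms(3)[OF that], of "h x"] by simp
  then show ?thesis unfolding logit_flow_def
    using assms by (intro continuous_intros ballI)
qed

section \<open>Shift and skew product\<close>

definition shift :: "int \<Rightarrow> (int \<Rightarrow> real) \<Rightarrow> int \<Rightarrow> real" where
  "shift k c = (\<lambda>i. c (i + k))"

lemma shift_in_codes: "c \<in> codes \<Longrightarrow> shift k c \<in> codes"
  by (simp add: codes_def shift_def)

lemma shift_zero [simp]: "shift k (\<lambda>_. 0) = (\<lambda>_. 0)"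
  by (simp add: shift_def)

text \<open>The letter is \<open>1 / Suc m\<close> with the sign of \<open>x\<close>, repeated as
  often as it fits into the absolute value of \<open>x\<close>.\<close>

lemma small_steps:
  fixes x :: real
  obtains n a where "a \<in> alphabet" "\<bar>real n * a - x\<bar> \<le> 1 / Suc m"
proof -
  define n where "n = nat \<lfloor>\<bar>x\<bar> * Suc m\<rfloor>"
  have "real n = \<lfloor>\<bar>x\<bar> * Suc m\<rfloor>" by (simp add: n_def)
  then have n: "real n \<le> \<bar>x\<bar> * Suc m" "\<bar>x\<bar> * Suc m \<le> real n + 1" by linarith+
  have "real n / Suc m \<le> \<bar>x\<bar>" "\<bar>x\<bar> \<le> real n / Suc m + 1 / Suc m"
    using n by (simp_all add: field_simps)
  then have "\<bar>real n / Suc m - \<bar>x\<bar>\<bar> \<le> 1 / Suc m" by linarith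
  then show thesis
    using that[of "1 / Suc m" n] that[of "- 1 / Suc m" n] inverse_Suc_in_alphabet[of m]
    by (cases "0 \<le> x") (auto simp: abs_le_iff algebra_simps)
qed

context folding
begin

definition skew :: "(int \<Rightarrow> real) \<times> real \<Rightarrow> (int \<Rightarrow> real) \<times> real" where
  "skew p = (shift 1 (fst p), logit_flow (snd p) (fst p 0))"

text \<open>The letter that \<open>skew\<close> reads at 0 stands at -1 after the shift.\<close>

definition skew_inv :: "(int \<Rightarrow> real) \<times> real \<Rightarrow> (int \<Rightarrow> real) \<times> real" where
  "skew_inv p = (shift (-1) (fst p), logit_flow (snd p) (- fst p (-1)))"

abbreviation QQ :: "(int \<Rightarrow> real) \<times> real \<Rightarrow> nat \<Rightarrow> real" where
  "QQ p \<equiv> Q (fst p) (snd p)"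

lemma skew_in: "p \<in> codes \<times> {0..1} \<Longrightarrow> skew p \<in> codes \<times> {0..1}"
  using shift_in_codes logit_flow_in by (auto simp: skew_def mem_Times_iff)

lemma skew_inv_in: "p \<in> codes \<times> {0..1} \<Longrightarrow> skew_inv p \<in> codes \<times> {0..1}"
  using shift_in_codes logit_flow_in by (auto simp: skew_inv_def mem_Times_iff)

lemma skew_inverse:
  assumes "p \<in> codes \<times> {0..1}"
  shows "skew (skew_inv p) = p" "skew_inv (skew p) = p"
  using assms by (auto simp: skew_def skew_inv_def logit_flow_add shift_def mem_Times_iff prod_eq_iff)

lemma continuous_on_code_coordinate: "continuous_on S (\<lambda>p :: (int \<Rightarrow> real) \<times> real. fst p i)"
  using continuous_on_product_then_coordinatewise[OF continuous_on_fst[OF continuous_on_id]] .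

lemma continuous_on_skew: "continuous_on (codes \<times> {0..1}) skew" "continuous_on (codes \<times> {0..1}) skew_inv"
  unfolding skew_def skew_inv_def shift_def
  by (intro continuous_on_Pair continuous_on_coordinatewise_then_product continuous_on_logit_flow
      continuous_on_minus continuous_on_code_coordinate continuous_on_snd continuous_on_id; auto)+

text \<open>\<open>QQ\<close> can identify pairs only over the zero code or at height 0, and there
  both maps leave the value of \<open>QQ\<close> unchanged; elsewhere the value determines the
  pair.\<close>

lemma skew_respects:
  assumes "QQ p = QQ r"
  shows "QQ (skew p) = QQ (skew r)" "QQ (skew_inv p) = QQ (skew_inv r)"
proof -
  have fixed: "QQ (skew p) = QQ p" "QQ (skew_inv p) = QQ p" if "fst p = (\<lambda>_. 0) \<or> snd p = 0" for p
    using that by (auto simp: skew_def skew_inv_def Q_base)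
  show "QQ (skew p) = QQ (skew r)" "QQ (skew_inv p) = QQ (skew_inv r)"
    using fixed[of p] fixed[of r] fold_map_inj[OF assms] fold_map_inj[OF assms[symmetric]] assms
    by (metis prod_eqI)+
qed

text \<open>The heights are moved by the Birkhoff sums of the letter at 0, since successive flow
  times add up.\<close>

lemma skew_power:
  assumes "c \<in> codes" "t \<in> {0..1}"
  shows "(skew ^^ n) (c, t) = (shift (int n) c, logit_flow t (\<Sum>i<n. c (int i)))"
proof (induction n)
  case 0
  show ?case by (simp add: shift_def)
next
  case (Suc n)
  then show ?case using assms
    by (simp add: skew_def logit_flow_add shift_def add.commute add.left_commute)
qed

section \<open>Transitivity by splicing codes\<close>

lemma continuous_QQ: "continuous_on (codes \<times> {0..1}) QQ"
  by (rule continuous_on_fold_map[OF cont_g])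

lemma QQ_tendsto:
  assumes "\<And>n. c n \<in> codes" "\<And>n. t n \<in> {0..1}" "d \<in> codes" "u \<in> {0..1}"
    and "\<And>i. (\<lambda>n. c n i) \<longlonglongrightarrow> d i" "t \<longlonglongrightarrow> u"
  shows "(\<lambda>n. Q (c n) (t n)) \<longlonglongrightarrow> Q d u"
proof -
  have "c \<longlonglongrightarrow> d"
    using assms(5) limitin_componentwise[of "\<lambda>_. euclidean" UNIV c d sequentially]
    by (simp add: euclidean_product_topology)
  then have "(\<lambda>n. (c n, t n)) \<longlonglongrightarrow> (d, u)" using assms(6) by (rule tendsto_Pair)
  then show ?thesis
    using continuous_on_tendsto_compose[OF continuous_QQ, of "\<lambda>n. (c n, t n)" "(d, u)" sequentially] assms(1-4)
    by simp
qed

text \<open>The code \<open>e\<close> follows \<open>c\<close> up to \<open>m\<close>, then repeats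
  one letter \<open>a\<close>, then follows a translate of \<open>d\<close>. The repeated letter
  corrects the sum without touching the two prescribed windows.\<close>

lemma splice:
  assumes c: "c \<in> codes" "d \<in> codes"
  obtains e N where "e \<in> codes" "\<And>i. \<bar>i\<bar> \<le> int m \<Longrightarrow> e i = c i"
    "\<And>i. \<bar>i\<bar> \<le> int m \<Longrightarrow> shift (int N) e i = d i"
    "\<bar>(\<Sum>i<N. e (int i)) - x\<bar> \<le> 1 / Suc m"
proof -
  \<comment> \<open>The contribution of the prescribed letters: those of \<open>c\<close> at 0 to
    \<open>m\<close> and those of \<open>d\<close> at \<open>-m\<close> to -1.\<close>
  define s where "s = (\<Sum>i<Suc m. c (int i)) + (\<Sum>i<m. d (int i - int m))"
  obtain n a where a: "a \<in> alphabet" "\<bar>real n * a - (x - s)\<bar> \<le> 1 / Suc m"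
    using small_steps by blast
  \<comment> \<open>After \<open>Suc m\<close> letters of \<open>c\<close>, \<open>n\<close> copies
    of \<open>a\<close> and \<open>m\<close> letters of \<open>d\<close>, position 0 of
    \<open>d\<close> is reached.\<close>
  define N where "N = Suc m + n + m"
  define e where "e = (\<lambda>i. if i \<le> int m then c i else if i \<le> int m + int n then a else d (i - int N))"
  have "e \<in> codes" using c a(1) by (auto simp: e_def codes_def)
  moreover have "e i = c i" if "\<bar>i\<bar> \<le> int m" for i using that by (simp add: e_def abs_le_iff)
  moreover have "shift (int N) e i = d i" if "\<bar>i\<bar> \<le> int m" for i
    using that by (auto simp: e_def shift_def N_def abs_le_iff)
  moreover have "(\<Sum>i<N. e (int i)) = s + real n * a"
  proof -
    have split: "(\<Sum>i<j + k. f i) = (\<Sum>i<j. f i) + (\<Sum>i<k. f (j + i))" for j k and f :: "nat \<Rightarrow> real"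
      by (induction k) auto
    have "(\<Sum>i<Suc m. e (int i)) = (\<Sum>i<Suc m. c (int i))"
      by (rule sum.cong) (auto simp: e_def)
    moreover have "(\<Sum>i<n. e (int (Suc m + i))) = (\<Sum>i<n. a)"
      by (rule sum.cong) (auto simp: e_def)
    moreover have "(\<Sum>i<m. e (int (Suc m + n + i))) = (\<Sum>i<m. d (int i - int m))"
      by (rule sum.cong) (auto simp: e_def N_def)
    ultimately show ?thesis unfolding N_def split s_def by simp
  qed
  then have "\<bar>(\<Sum>i<N. e (int i)) - x\<bar> \<le> 1 / Suc m" using a(2) by (simp add: algebra_simps)
  ultimately show thesis using that by blast
qed

text \<open>The flow fixes the heights 0 and 1 and can join only heights strictly between them; such
  points are dense.\<close>

lemma interior_point:
  assumes "openin (top_of_set (folded_fan g)) U" "U \<noteq> {}"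
  obtains c t where "c \<in> codes" "0 < t" "t < 1" "Q c t \<in> U"
proof -
  obtain x where x: "x \<in> U" "x \<in> folded_fan g" using assms openin_subset by fastforce
  then obtain c t where c: "c \<in> codes" "t \<in> {0..1}" "x = Q c t" using folded_fan_cases by blast
  \<comment> \<open>Convex combinations of \<open>t\<close> and 1/2 with positive weight on 1/2,
    tending to \<open>t\<close>.\<close>
  define r where "r = (\<lambda>n. t + (1/2 - t) * (1 / Suc (Suc n)))"
  have rb: "0 < r n \<and> r n < 1" for n
  proof -
    define y where "y = 1 / real (Suc (Suc n))"
    have y: "0 < y" "y < 1" by (auto simp: y_def)
    have "r n = t + (1/2 - t) * y" by (simp add: r_def y_def)
    then have "r n = (1 - y) * t + y * (1/2)" by (simp add: algebra_simps)
    moreover have "0 \<le> (1 - y) * t" "(1 - y) * t \<le> (1 - y) * 1" using y c by (auto intro: mult_left_mono)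
    ultimately show ?thesis using y by (auto simp: algebra_simps)
  qed
  have "(\<lambda>n. 1 / real (Suc (Suc n))) \<longlonglongrightarrow> 0"
    using LIMSEQ_Suc[OF LIMSEQ_inverse_real_of_nat] by (simp add: inverse_eq_divide)
  then have "r \<longlonglongrightarrow> t + (1/2 - t) * 0" unfolding r_def by (intro tendsto_intros)
  then have "(\<lambda>n. Q c (r n)) \<longlonglongrightarrow> Q c t"
    using c rb by (intro QQ_tendsto) (auto simp: less_imp_le)
  moreover obtain W where W: "open W" "U = folded_fan g \<inter> W" using assms(1) by (auto simp: openin_open)
  ultimately have "\<forall>\<^sub>F n in sequentially. Q c (r n) \<in> W" using x c by (intro topological_tendstoD) auto
  then obtain n where "Q c (r n) \<in> W" by (auto simp: eventually_sequentially)
  then have "Q c (r n) \<in> U" using W in_folded_fan[of c "r n" g] c rb[of n] by (simp add: less_imp_le)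
  then show thesis using that[of c "r n"] c rb by blast
qed

text \<open>Choose the flow time \<open>x\<close> from height \<open>t\<close> to \<open>u\<close>.
  Spliced codes start ever closer to \<open>c\<close>, arrive ever closer to \<open>d\<close>, and
  have Birkhoff sums tending to \<open>x\<close>, so for large \<open>m\<close> both ends of the
  orbit segment lie in the given open sets.\<close>

lemma skew_mixes:
  assumes U: "openin (top_of_set (folded_fan g)) U" "U \<noteq> {}"
    and V: "openin (top_of_set (folded_fan g)) V" "V \<noteq> {}"
  obtains p n where "p \<in> codes \<times> {0..1}" "QQ p \<in> U" "QQ ((skew ^^ n) p) \<in> V"
proof -
  obtain c t where c: "c \<in> codes" "0 < t" "t < 1" "Q c t \<in> U" using interior_point U by blast
  obtain d u where d: "d \<in> codes" "0 < u" "u < 1" "Q d u \<in> V" using interior_point V by blast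
  obtain x where x: "logit_flow t x = u" using logit_flow_transitive c d by metis
  have "\<forall>m. \<exists>e N. e \<in> codes \<and> (\<forall>i. \<bar>i\<bar> \<le> int m \<longrightarrow> e i = c i) \<and>
    (\<forall>i. \<bar>i\<bar> \<le> int m \<longrightarrow> shift (int N) e i = d i) \<and> \<bar>(\<Sum>i<N. e (int i)) - x\<bar> \<le> 1 / Suc m"
    using splice[OF c(1) d(1)] by metis
  then obtain e N where e: "\<And>m. e m \<in> codes" "\<And>m i. \<bar>i\<bar> \<le> int m \<Longrightarrow> e m i = c i"
    "\<And>m i. \<bar>i\<bar> \<le> int m \<Longrightarrow> shift (int (N m)) (e m) i = d i"
    "\<And>m. \<bar>(\<Sum>i<N m. e m (int i)) - x\<bar> \<le> 1 / Suc m" by metis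
  have t: "t \<in> {0..1}" using c by simp
  have ev: "\<forall>\<^sub>F m in sequentially. \<bar>i\<bar> \<le> int m" for i
    using eventually_ge_at_top[of "nat \<bar>i\<bar>"] by eventually_elim simp
  have "(\<lambda>m. Q (e m) t) \<longlonglongrightarrow> Q c t"
  proof (rule QQ_tendsto)
    show "(\<lambda>m. e m i) \<longlonglongrightarrow> c i" for i
      by (rule tendsto_eventually, rule eventually_mono[OF ev[of i]], rule e(2))
  qed (use e(1) c t in auto)
  moreover have "(\<lambda>m. Q (shift (int (N m)) (e m)) (logit_flow t (\<Sum>i<N m. e m (int i)))) \<longlonglongrightarrow> Q d u"
  proof (rule QQ_tendsto)
    have "(\<lambda>m. (\<Sum>i<N m. e m (int i)) - x) \<longlonglongrightarrow> 0"
      by (rule tendsto_rabs_zero_cancel, rule tendsto_sandwich[OF _ _ tendsto_const])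
         (use e(4) LIMSEQ_inverse_real_of_nat in \<open>auto simp: inverse_eq_divide\<close>)
    then have "(\<lambda>m. \<Sum>i<N m. e m (int i)) \<longlonglongrightarrow> x" by (simp add: LIM_zero_iff)
    then have "(\<lambda>m. logit_flow t (\<Sum>i<N m. e m (int i))) \<longlonglongrightarrow> logit_flow t x"
      using logit_flow_denom[OF t, of x] unfolding logit_flow_def by (intro tendsto_intros) auto
    then show "(\<lambda>m. logit_flow t (\<Sum>i<N m. e m (int i))) \<longlonglongrightarrow> u" using x by simp
    show "(\<lambda>m. shift (int (N m)) (e m) i) \<longlonglongrightarrow> d i" for i
      by (rule tendsto_eventually, rule eventually_mono[OF ev[of i]], rule e(3))
  qed (use e(1) shift_in_codes logit_flow_in t d in auto)
  moreover obtain W where W: "open W" "U = folded_fan g \<inter> W" using U(1) by (auto simp: openin_open)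
  moreover obtain W' where W': "open W'" "V = folded_fan g \<inter> W'" using V(1) by (auto simp: openin_open)
  ultimately have "\<forall>\<^sub>F m in sequentially. Q (e m) t \<in> W \<and>
      Q (shift (int (N m)) (e m)) (logit_flow t (\<Sum>i<N m. e m (int i))) \<in> W'"
    using c(4) d(4) by (intro eventually_conj; intro topological_tendstoD) auto
  then obtain m where m: "Q (e m) t \<in> W" "Q (shift (int (N m)) (e m)) (logit_flow t (\<Sum>i<N m. e m (int i))) \<in> W'"
    by (auto simp: eventually_sequentially)
  show thesis
  proof (rule that[of "(e m, t)" "N m"])
    show "(e m, t) \<in> codes \<times> {0..1}" using e(1) t by simp
    show "QQ (e m, t) \<in> U" using m(1) W in_folded_fan e(1) t by simp
    show "QQ ((skew ^^ N m) (e m, t)) \<in> V"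
      using m(2) W' in_folded_fan e(1) t shift_in_codes logit_flow_in by (simp add: skew_power)
  qed
qed

lemma transitive_homeomorphism_folded_fan: "\<exists>f. transitive_homeomorphism (folded_fan g) f"
proof -
  let ?K = "codes \<times> {0..1::real}"
  have K: "compact ?K" using compact_codes by (simp add: compact_Times)
  have X: "QQ ` ?K = folded_fan g" by (simp add: folded_fan_def)
  have c1: "continuous_on ?K (\<lambda>p. QQ (skew p))"
    by (rule continuous_on_compose2[OF continuous_QQ continuous_on_skew(1)]) (use skew_in in blast)
  have c2: "continuous_on ?K (\<lambda>p. QQ (skew_inv p))"
    by (rule continuous_on_compose2[OF continuous_QQ continuous_on_skew(2)]) (use skew_inv_in in blast)
  obtain f where f: "continuous_on (folded_fan g) f" "\<And>p. p \<in> ?K \<Longrightarrow> f (QQ p) = QQ (skew p)"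
    using descends_to_quotient[OF K continuous_QQ c1, unfolded X] skew_respects(1) by blast
  obtain h where h: "continuous_on (folded_fan g) h" "\<And>p. p \<in> ?K \<Longrightarrow> h (QQ p) = QQ (skew_inv p)"
    using descends_to_quotient[OF K continuous_QQ c2, unfolded X] skew_respects(2) by blast
  have X_cases: "\<exists>p\<in>?K. x = QQ p" if "x \<in> folded_fan g" for x using that X by blast
  have fX: "f x \<in> folded_fan g" "h (f x) = x" "h x \<in> folded_fan g" "f (h x) = x" if "x \<in> folded_fan g" for x
  proof -
    note x = that
    obtain p where p: "p \<in> ?K" "x = QQ p" using X_cases[OF x] by blast
    have in_X: "QQ r \<in> folded_fan g" if "r \<in> ?K" for r using that X by blast
    show "f x \<in> folded_fan g" "h (f x) = x" "h x \<in> folded_fan g" "f (h x) = x"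
      using p f(2) h(2) skew_in skew_inv_in skew_inverse in_X by simp_all
  qed
  have "homeomorphism (folded_fan g) (folded_fan g) f h"
    using f(1) h(1) fX by (intro homeomorphismI) auto
  moreover have iter: "(f ^^ n) (QQ p) = QQ ((skew ^^ n) p) \<and> (skew ^^ n) p \<in> ?K" if "p \<in> ?K" for p n
    using that by (induction n) (simp_all only: funpow.simps id_apply comp_apply f(2) skew_in)
  have "\<exists>n. (f ^^ n) ` U \<inter> V \<noteq> {}" if "openin (top_of_set (folded_fan g)) U \<and> U \<noteq> {} \<and>
    openin (top_of_set (folded_fan g)) V \<and> V \<noteq> {}" for U V
  proof -
    note UV = that
    obtain p n where p: "p \<in> ?K" "QQ p \<in> U" "QQ ((skew ^^ n) p) \<in> V"
      using skew_mixes[of U V] UV by blast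
    then have "(f ^^ n) (QQ p) \<in> (f ^^ n) ` U" "(f ^^ n) (QQ p) \<in> V"
      using iter[of p n] by (blast, simp)
    then show ?thesis by blast
  qed
  ultimately show ?thesis unfolding transitive_homeomorphism_def by blast
qed

end

section \<open>The fold pattern as a topological invariant\<close>

lemma infdist_le_hausdorff_dist:
  assumes "compact A" "a \<in> A"
  shows "infdist a B \<le> hausdorff_dist A B"
proof -
  have "continuous_on A (\<lambda>x. infdist x B)" by (intro continuous_on_infdist continuous_on_id)
  \<comment> \<open>Boundedness makes the \<open>SUP\<close> in the Hausdorff distance a genuine
    upper bound.\<close>
  then have "bdd_above ((\<lambda>x. infdist x B) ` A)"
    by (intro bounded_imp_bdd_above compact_imp_bounded compact_continuous_image assms(1))
  then show ?thesis unfolding hausdorff_dist_def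
    using cSUP_upper[OF assms(2), of "\<lambda>x. infdist x B"] by linarith
qed

text \<open>Stated with some arc instead of \<open>arc_in\<close>, which makes transport along
  homeomorphisms direct. The first disjunct covers \<open>x = v\<close>, to which no arc from
  \<open>v\<close> leads.\<close>

definition below :: "'a::metric_space set \<Rightarrow> 'a \<Rightarrow> 'a \<Rightarrow> 'a \<Rightarrow> bool" where
  "below X v y x \<longleftrightarrow> x \<in> X \<and> y = x \<or> (\<exists>A\<subseteq>X. arc_with_ends v x A \<and> y \<in> A)"

text \<open>The closure of the arc order in the square of \<open>X\<close>, expressed by
  sequences.\<close>

definition limit_below :: "'a::metric_space set \<Rightarrow> 'a \<Rightarrow> 'a \<Rightarrow> 'a \<Rightarrow> bool" where
  "limit_below X v y x \<longleftrightarrow> y \<in> X \<and> x \<in> X \<and>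
     (\<exists>ys xs. (\<forall>n. below X v (ys n) (xs n)) \<and> ys \<longlonglongrightarrow> y \<and> xs \<longlonglongrightarrow> x)"

lemma limit_belowI:
  assumes "y \<in> X" "x \<in> X" "\<And>n. below X v (ys n) (xs n)" "ys \<longlonglongrightarrow> y" "xs \<longlonglongrightarrow> x"
  shows "limit_below X v y x"
  unfolding limit_below_def using assms by (intro conjI exI[of _ ys] exI[of _ xs] allI)

definition anomalous :: "'a::metric_space set \<Rightarrow> 'a \<Rightarrow> 'a \<Rightarrow> 'a \<Rightarrow> bool" where
  "anomalous X v y x \<longleftrightarrow> limit_below X v y x \<and> \<not> below X v y x"

text \<open>In the fans below these are exactly the upper ends of the folds, see
  \<open>peak_iff\<close>.\<close>

definition peak :: "'a::metric_space set \<Rightarrow> 'a \<Rightarrow> 'a \<Rightarrow> bool" where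
  "peak X v y \<longleftrightarrow> (\<exists>x. anomalous X v y x \<and> (\<forall>z. anomalous X v z x \<longrightarrow> below X v z y))"

section \<open>Invariance under homeomorphisms\<close>

lemma arc_with_ends_image:
  assumes "arc_with_ends x y A" "continuous_on A f" "inj_on f A"
  shows "arc_with_ends (f x) (f y) (f ` A)"
proof -
  obtain p where p: "arc p" "path_image p = A" "pathstart p = x" "pathfinish p = y"
    using assms(1) by (auto simp: arc_with_ends_def)
  then have "continuous_on {0..1} (f \<circ> p)" "inj_on (f \<circ> p) {0..1}"
    using assms(2,3) continuous_on_compose[of "{0..1}" p f] comp_inj_on[of p "{0..1}" f]
    unfolding arc_def path_def path_image_def by simp_all
  then have "arc (f \<circ> p)" by (simp add: arc_def path_def)
  moreover have "path_image (f \<circ> p) = f ` A" using p(2) by (auto simp: path_image_def)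
  moreover have "pathstart (f \<circ> p) = f x" "pathfinish (f \<circ> p) = f y"
    using p(3,4) by (auto simp: pathstart_def pathfinish_def)
  ultimately show ?thesis unfolding arc_with_ends_def by blast
qed

lemma ramification_point_image:
  assumes "homeomorphism X Y f h" "ramification_point X x"
  shows "ramification_point Y (f x)"
proof -
  obtain T p q where T: "T \<subseteq> X" "homeomorphism standard_triod T p q" "p (0, 0) = x"
    using assms(2) by (auto simp: ramification_point_def triod_with_top_def)
  have "homeomorphism T (f ` T) f h" using homeomorphism_of_subsets[OF assms(1) T(1)] by blast
  then have "homeomorphism standard_triod (f ` T) (f \<circ> p) (q \<circ> h)"
    using homeomorphism_compose[OF T(2)] by blast
  moreover have "f ` T \<subseteq> Y" using T(1) homeomorphism_image1[OF assms(1)] by blast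
  moreover have "(f \<circ> p) (0, 0) = f x" using T(3) by simp
  ultimately show ?thesis unfolding ramification_point_def triod_with_top_def by blast
qed

lemma below_in: "below X v y x \<Longrightarrow> y \<in> X \<and> x \<in> X"
  by (auto simp: below_def arc_with_ends_def)

lemma below_image:
  assumes f: "homeomorphism X Y f h" and b: "below X v y x"
  shows "below Y (f v) (f y) (f x)"
proof (cases "y = x")
  case True
  then show ?thesis using below_in[OF b] homeomorphism_image1[OF f] by (auto simp: below_def)
next
  case False
  then obtain A where A: "A \<subseteq> X" "arc_with_ends v x A" "y \<in> A" using b by (auto simp: below_def)
  have "continuous_on A f" using continuous_on_subset[OF homeomorphism_cont1[OF f] A(1)] .
  moreover have "inj_on f A"
    using A(1) homeomorphism_apply1[OF f] by (metis inj_on_def subsetD)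
  ultimately have "arc_with_ends (f v) (f x) (f ` A)" using arc_with_ends_image A(2) by blast
  moreover have "f ` A \<subseteq> Y" using A(1) homeomorphism_image1[OF f] by blast
  ultimately show ?thesis using A(3) unfolding below_def by blast
qed

lemma limit_below_image:
  assumes f: "homeomorphism X Y f h" and b: "limit_below X v y x"
  shows "limit_below Y (f v) (f y) (f x)"
proof -
  obtain ys xs where s: "\<And>n. below X v (ys n) (xs n)" "ys \<longlonglongrightarrow> y" "xs \<longlonglongrightarrow> x"
    and X: "y \<in> X" "x \<in> X" using b by (auto simp: limit_below_def)
  have l1: "(\<lambda>n. f (ys n)) \<longlonglongrightarrow> f y"
    using below_in[OF s(1)] by (intro continuous_on_tendsto_compose[OF homeomorphism_cont1[OF f] s(2) X(1)]) simp
  have l2: "(\<lambda>n. f (xs n)) \<longlonglongrightarrow> f x"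
    using below_in[OF s(1)] by (intro continuous_on_tendsto_compose[OF homeomorphism_cont1[OF f] s(3) X(2)]) simp
  have "f y \<in> Y" "f x \<in> Y" using X homeomorphism_image1[OF f] by blast+
  then show ?thesis by (rule limit_belowI[OF _ _ below_image[OF f s(1)] l1 l2])
qed

lemma anomalous_image:
  assumes f: "homeomorphism X Y f h" and v: "v \<in> X" and b: "anomalous X v y x"
  shows "anomalous Y (f v) (f y) (f x)"
proof -
  have X: "y \<in> X" "x \<in> X" using b by (auto simp: anomalous_def limit_below_def)
  then have "below Y (f v) (f y) (f x) \<Longrightarrow> below X v y x"
    using below_image[OF homeomorphism_symD[OF f], of "f v" "f y" "f x"] v homeomorphism_apply1[OF f] by simp
  then show ?thesis using b limit_below_image[OF f] by (auto simp: anomalous_def)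
qed

lemma peak_image:
  assumes f: "homeomorphism X Y f h" and v: "v \<in> X" and b: "peak X v y"
  shows "peak Y (f v) (f y)"
proof -
  obtain x where x: "anomalous X v y x" "\<And>z. anomalous X v z x \<Longrightarrow> below X v z y"
    using b by (auto simp: peak_def)
  have xX: "x \<in> X" using x(1) by (simp add: anomalous_def limit_below_def)
  have "below Y (f v) z (f y)" if "anomalous Y (f v) z (f x)" for z
  proof -
    have z: "z \<in> Y" using that by (simp add: anomalous_def limit_below_def)
    have "anomalous X v (h z) x"
      using anomalous_image[OF homeomorphism_symD[OF f] _ that] v xX homeomorphism_image1[OF f]
        homeomorphism_apply1[OF f] by auto
    then have "below Y (f v) (f (h z)) (f y)" using x(2) below_image[OF f] by blast
    then show ?thesis using homeomorphism_apply2[OF f z] by simp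
  qed
  then show ?thesis using anomalous_image[OF f v x(1)] unfolding peak_def by blast
qed

section \<open>The arc order of a folded fan and its closure\<close>

lemma (in hedgehog) below_lam:
  assumes "c \<in> I" "s \<in> {0..1}"
  shows "below X v y (lam c s) \<longleftrightarrow> y \<in> lam c ` {0..s}"
proof (cases "s = 0")
  case True
  then have "\<not> (A \<subseteq> X \<and> arc_with_ends v (lam c s) A)" for A using arc_from_v_iff[OF assms] by blast
  then show ?thesis using True assms v_in_X by (auto simp: below_def)
next
  case False
  have "lam c s \<in> lam c ` {0..s}" using assms by simp
  moreover have "below X v y (lam c s) \<longleftrightarrow> lam c s \<in> X \<and> y = lam c s \<or> (\<exists>A. (A \<subseteq> X \<and> arc_with_ends v (lam c s) A) \<and> y \<in> A)"
    unfolding below_def by blast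
  ultimately show ?thesis unfolding arc_from_v_iff[OF assms] using False in_X[OF assms] by blast
qed

text \<open>Nonzero codes that converge to the zero code, because the single 1 moves off to
  infinity. Their unfolded legs approach the folded leg along \<open>g\<close>.\<close>

definition spike :: "nat \<Rightarrow> int \<Rightarrow> real" where
  "spike n = (\<lambda>i. if i = int n then 1 else 0)"

lemma spike_in_codes: "spike n \<in> codes"
  using inverse_Suc_in_alphabet(1)[of 0] by (simp add: spike_def codes_def)

lemma spike_nonzero: "spike n \<noteq> (\<lambda>_. 0)"
  by (auto simp: spike_def fun_eq_iff intro!: exI[of _ "int n"])

lemma spike_tendsto: "(\<lambda>n. spike n i) \<longlonglongrightarrow> 0"
proof (rule tendsto_eventually)
  show "\<forall>\<^sub>F n in sequentially. spike n i = 0"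
    using eventually_gt_at_top[of "nat \<bar>i\<bar>"] by eventually_elim (auto simp: spike_def)
qed

context folding
begin

text \<open>Of interest for \<open>a < b\<close>: the neighbouring legs then pass near height
  \<open>b\<close> before they come to height \<open>a\<close>.\<close>

definition folds :: "real \<Rightarrow> real \<Rightarrow> bool" where
  "folds a b \<longleftrightarrow> (\<exists>s t. 0 \<le> s \<and> s \<le> t \<and> t \<le> 1 \<and> g s = b \<and> g t = a)"

lemma folds_in: "folds a b \<Longrightarrow> a \<in> {0..1} \<and> b \<in> {0..1}"
  using g_in unfolding folds_def by fastforce

abbreviation fan_below where "fan_below \<equiv> below (folded_fan g) top_pt"
abbreviation fan_limit_below where "fan_limit_below \<equiv> limit_below (folded_fan g) top_pt"
abbreviation fan_anomalous where "fan_anomalous \<equiv> anomalous (folded_fan g) top_pt"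
abbreviation zleg where "zleg \<equiv> leg (\<lambda>_. 0)"

lemma spike_Q_tendsto: "t \<in> {0..1} \<Longrightarrow> (\<lambda>n. Q (spike n) t) \<longlonglongrightarrow> Q (\<lambda>_. 0) t"
  using spike_in_codes spike_tendsto by (intro QQ_tendsto) auto

lemma below_Q:
  assumes "c \<in> codes" "c \<noteq> (\<lambda>_. 0)" "0 \<le> s" "s \<le> t" "t \<le> 1"
  shows "fan_below (Q c s) (Q c t)"
  using below_lam[of c t "Q c s"] assms by (simp add: leg_nonzero)

text \<open>Over the zero code the pair is approached along the spike codes, on whose legs the arc
  order is the order of parameters.\<close>

lemma limit_below_Q:
  assumes c: "c \<in> codes" and st: "0 \<le> s" "s \<le> t" "t \<le> 1"
  shows "fan_limit_below (Q c s) (Q c t)"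
proof -
  have X: "Q c s \<in> folded_fan g" "Q c t \<in> folded_fan g" using in_folded_fan c st by auto
  show ?thesis
  proof (cases "c = (\<lambda>_. 0)")
    case True
    have b: "fan_below (Q (spike n) s) (Q (spike n) t)" for n
      using below_Q spike_in_codes spike_nonzero st by blast
    have l: "(\<lambda>n. Q (spike n) s) \<longlonglongrightarrow> Q c s" "(\<lambda>n. Q (spike n) t) \<longlonglongrightarrow> Q c t"
      using spike_Q_tendsto True st by auto
    show ?thesis by (rule limit_belowI[OF X b l])
  next
    case False
    show ?thesis
      by (rule limit_belowI[OF X _ tendsto_const tendsto_const]) (rule below_Q[OF c False st])
  qed
qed

text \<open>On the folded leg, heights must be lifted to parameters in the right order; the
  intermediate value theorem finds the lower one before the upper one.\<close>

lemma below_cases: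
  assumes "fan_below y x"
  obtains c s t where "c \<in> codes" "0 \<le> s" "s \<le> t" "t \<le> 1" "y = Q c s" "x = Q c t"
proof -
  obtain c t where c: "c \<in> codes" "t \<in> {0..1}" "x = leg c t" using X_cases[of x] below_in[OF assms] by blast
  then obtain s where s: "0 \<le> s" "s \<le> t" "y = leg c s" using assms below_lam by auto
  show thesis
  proof (cases "c = (\<lambda>_. 0)")
    case True
    obtain t' where t': "t' \<in> {0..1}" "g t' = t" using c g_image by (metis imageE)
    have "continuous_on {0..t'} g" using cont_g t' by (rule_tac continuous_on_subset) auto
    then obtain s' where s': "0 \<le> s'" "s' \<le> t'" "g s' = s"
      using IVT'[of g 0 s t'] s t' by auto
    then show thesis using that[of c s' t'] c s t' True by (simp add: Q_zero)
  next
    case False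
    then show thesis using that[of c s t] c s by (simp add: leg_nonzero)
  qed
qed

text \<open>The pairs on the right form a compact image, hence a closed relation. It contains the
  arc order by \<open>below_cases\<close> and lies in its closure by
  \<open>limit_below_Q\<close>.\<close>

lemma limit_below_iff:
  "fan_limit_below y x \<longleftrightarrow> (\<exists>c\<in>codes. \<exists>s t. 0 \<le> s \<and> s \<le> t \<and> t \<le> 1 \<and> y = Q c s \<and> x = Q c t)"
proof
  assume "\<exists>c\<in>codes. \<exists>s t. 0 \<le> s \<and> s \<le> t \<and> t \<le> 1 \<and> y = Q c s \<and> x = Q c t"
  then show "fan_limit_below y x" using limit_below_Q by blast
next
  assume lim: "fan_limit_below y x"
  define S where "S = (codes \<times> {0..1::real} \<times> {0..1::real}) \<inter> {p. fst (snd p) \<le> snd (snd p)}"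
  define F where "F = (\<lambda>p. (Q (fst p) (fst (snd p)), Q (fst p) (snd (snd p))))"
  have "compact S" unfolding S_def
    by (intro compact_Int_closed compact_Times compact_codes closed_Collect_le continuous_intros) auto
  moreover have "continuous_on S F" unfolding F_def
  proof (rule continuous_on_Pair)
    have c: "continuous_on S (\<lambda>p. (fst p, fst (snd p)))" "continuous_on S (\<lambda>p. (fst p, snd (snd p)))"
      by (intro continuous_intros)+
    have sub: "(\<lambda>p. (fst p, fst (snd p))) ` S \<subseteq> codes \<times> {0..1}"
      "(\<lambda>p. (fst p, snd (snd p))) ` S \<subseteq> codes \<times> {0..1}"
      by (auto simp: S_def)
    show "continuous_on S (\<lambda>p. Q (fst p) (fst (snd p)))"
      using continuous_on_compose2[OF continuous_QQ c(1) sub(1)] by simp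
    show "continuous_on S (\<lambda>p. Q (fst p) (snd (snd p)))"
      using continuous_on_compose2[OF continuous_QQ c(2) sub(2)] by simp
  qed
  ultimately have cl: "closed (F ` S)" using compact_continuous_image compact_imp_closed by blast
  obtain ys xs where s: "\<And>n. fan_below (ys n) (xs n)" "ys \<longlonglongrightarrow> y" "xs \<longlonglongrightarrow> x"
    using lim by (auto simp: limit_below_def)
  have "(ys n, xs n) \<in> F ` S" for n
  proof -
    obtain c s t where "c \<in> codes" "0 \<le> s" "s \<le> t" "t \<le> 1" "ys n = Q c s" "xs n = Q c t"
      using below_cases[OF s(1)] by metis
    then show ?thesis by (intro image_eqI[of _ _ "(c, s, t)"]) (auto simp: F_def S_def)
  qed
  moreover have "(\<lambda>n. (ys n, xs n)) \<longlonglongrightarrow> (y, x)" using s by (intro tendsto_Pair)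
  ultimately have "(y, x) \<in> F ` S"
    using closed_sequentially[OF cl, of "\<lambda>n. (ys n, xs n)" "(y, x)"] by blast
  then obtain c s t where "c \<in> codes" "0 \<le> s" "s \<le> t" "t \<le> 1" "y = Q c s" "x = Q c t"
    unfolding F_def S_def by auto
  then show "\<exists>c\<in>codes. \<exists>s t. 0 \<le> s \<and> s \<le> t \<and> t \<le> 1 \<and> y = Q c s \<and> x = Q c t" by blast
qed

lemma zleg_eq_iff [simp]: "zleg a = zleg b \<longleftrightarrow> a = b"
  unfolding leg_zero by metis

lemma below_zleg:
  assumes "a \<in> {0..1}" "b \<in> {0..1}"
  shows "fan_below (zleg b) (zleg a) \<longleftrightarrow> b \<le> a"
  using below_lam[OF zero_in_codes assms(1), of "zleg b"] assms by (simp add: image_iff)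

text \<open>On unfolded legs the parameter order is the arc order, so closing up adds nothing there.
  On the folded leg the arc order compares heights, and new pairs come from parameters whose order
  \<open>g\<close> reverses.\<close>

lemma anomalous_iff:
  "fan_anomalous y x \<longleftrightarrow> (\<exists>a b. a < b \<and> folds a b \<and> x = zleg a \<and> y = zleg b)"
proof
  assume "fan_anomalous y x"
  then obtain c s t where c: "c \<in> codes" "0 \<le> s" "s \<le> t" "t \<le> 1" "y = Q c s" "x = Q c t"
    and nb: "\<not> fan_below y x" unfolding anomalous_def limit_below_iff by blast
  then have "c = (\<lambda>_. 0)" using below_Q by blast
  then have e: "y = zleg (g s)" "x = zleg (g t)" using c Q_zero by auto
  moreover have "g t < g s" using nb below_zleg[of "g t" "g s"] g_in[of s] g_in[of t] c e by auto
  moreover have "folds (g t) (g s)" using c unfolding folds_def by blast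
  ultimately show "\<exists>a b. a < b \<and> folds a b \<and> x = zleg a \<and> y = zleg b" by blast
next
  assume "\<exists>a b. a < b \<and> folds a b \<and> x = zleg a \<and> y = zleg b"
  then obtain a b where ab: "a < b" "folds a b" "x = zleg a" "y = zleg b" by blast
  obtain s t where st: "0 \<le> s" "s \<le> t" "t \<le> 1" "g s = b" "g t = a" using ab(2) by (auto simp: folds_def)
  have "y = Q (\<lambda>_. 0) s" "x = Q (\<lambda>_. 0) t" using ab st Q_zero by auto
  then have "fan_limit_below y x" using limit_below_Q[OF zero_in_codes st(1-3)] by simp
  moreover have "\<not> fan_below y x" using below_zleg[of a b] g_in[of s] g_in[of t] st ab by auto
  ultimately show "fan_anomalous y x" by (simp add: anomalous_def)
qed

text \<open>The points at parameter \<open>t\<close> on the spike legs tend to height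
  \<open>a\<close> of the folded leg, while the arcs to them pass through the points at parameter
  \<open>s\<close>. These tend to height \<open>b\<close>, which is off the arc to height
  \<open>a\<close>.\<close>

lemma not_smooth:
  assumes "folds a b" "a < b"
  shows "\<not> smooth_at_top (folded_fan g) top_pt"
proof
  assume sm: "smooth_at_top (folded_fan g) top_pt"
  obtain s t where st: "0 \<le> s" "s \<le> t" "t \<le> 1" "g s = b" "g t = a" using assms(1) by (auto simp: folds_def)
  have t: "t \<in> {0..1}" and s: "s \<in> {0..1}" and a: "a \<in> {0..1}" and b: "b \<in> {0..1}"
    using st g_in[of s] g_in[of t] by auto
  let ?B = "arc_in (folded_fan g) top_pt (zleg a)"
  have B: "?B = zleg ` {0..a}" using arc_in_v[OF zero_in_codes a] .
  have "compact ?B" unfolding B using a by (intro compact_continuous_image cont_sub zero_in_codes) auto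
  then have "closed ?B" "?B \<noteq> {}" using compact_imp_closed a unfolding B by auto
  moreover have "zleg b \<notin> ?B" unfolding B using assms(2) by (simp add: image_iff)
  ultimately have pos: "infdist (zleg b) ?B \<noteq> 0" using in_closed_iff_infdist_zero by blast
  have X: "Q (spike n) t \<in> folded_fan g" for n using in_folded_fan spike_in_codes t by blast
  have "(\<lambda>n. Q (spike n) t) \<longlonglongrightarrow> zleg a" using spike_Q_tendsto[OF t] Q_zero st by simp
  moreover have "zleg a \<in> folded_fan g" using in_X zero_in_codes a by blast
  ultimately have lim: "(\<lambda>n. hausdorff_dist (arc_in (folded_fan g) top_pt (Q (spike n) t)) ?B) \<longlonglongrightarrow> 0"
    using sm[unfolded smooth_at_top_def, rule_format, of "zleg a" "\<lambda>n. Q (spike n) t"] X by blast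
  have "infdist (Q (spike n) s) ?B \<le> hausdorff_dist (arc_in (folded_fan g) top_pt (Q (spike n) t)) ?B" for n
  proof (rule infdist_le_hausdorff_dist)
    have leg: "leg (spike n) = Q (spike n)" by (rule leg_nonzero[OF spike_nonzero])
    have A: "arc_in (folded_fan g) top_pt (Q (spike n) t) = Q (spike n) ` {0..t}"
      using arc_in_v[OF spike_in_codes t, of n] unfolding leg .
    show "compact (arc_in (folded_fan g) top_pt (Q (spike n) t))"
      unfolding A using t cont_sub[OF spike_in_codes, of "{0..t}" n, unfolded leg]
      by (intro compact_continuous_image) auto
    show "Q (spike n) s \<in> arc_in (folded_fan g) top_pt (Q (spike n) t)" unfolding A using st by simp
  qed
  moreover have "(\<lambda>n. infdist (Q (spike n) s) ?B) \<longlonglongrightarrow> infdist (zleg b) ?B"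
    using spike_Q_tendsto[OF s] Q_zero st by (intro tendsto_infdist) simp
  ultimately have "infdist (zleg b) ?B \<le> 0" using LIMSEQ_le[OF _ lim, of "\<lambda>n. infdist (Q (spike n) s) ?B"] by blast
  then show False using pos infdist_nonneg[of "zleg b" ?B] by linarith
qed

lemma nonsmooth_folded_fan: "folds a b \<Longrightarrow> a < b \<Longrightarrow> nonsmooth_fan (folded_fan g)"
  using not_smooth is_top_v unfolding nonsmooth_fan_def by blast

end

section \<open>Folds over successive, possibly touching intervals of heights\<close>

locale step_folding = folding +
  fixes A B :: "nat \<Rightarrow> real"
  assumes AB: "A n < B n" and BA: "B n \<le> A (Suc n)"
    and folds_iff: "a < b \<Longrightarrow> folds a b \<longleftrightarrow> (\<exists>n. A n \<le> a \<and> b \<le> B n)"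
begin

lemma mono_A: "m \<le> n \<Longrightarrow> A m \<le> A n"
proof -
  have "A k \<le> A (Suc k)" for k using AB[of k] BA[of k] by linarith
  then show "m \<le> n \<Longrightarrow> A m \<le> A n" by (rule lift_Suc_mono_le)
qed

lemma B_le_A: "m < n \<Longrightarrow> B m \<le> A n"
  using BA[of m] mono_A[of "Suc m" n] by simp

lemma mono_B: "m < n \<Longrightarrow> B m < B n"
  using B_le_A[of m n] AB[of n] by simp

lemma folds_AB: "folds (A n) (B n)"
  using folds_iff AB by blast

lemma B_in: "B n \<in> {0..1}"
  using folds_AB[of n] folds_in by blast

lemma cell_unique: "A m \<le> a \<Longrightarrow> a < B m \<Longrightarrow> A n \<le> a \<Longrightarrow> a < B n \<Longrightarrow> m = n"
  using B_le_A[of m n] B_le_A[of n m] by (cases m n rule: linorder_cases) simp_all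

text \<open>If \<open>a\<close> and \<open>b\<close> lie in the interval from \<open>A n\<close> to
  \<open>B n\<close>, then \<open>B n\<close> is anomalous over \<open>a\<close> too, so a greatest
  such point is \<open>B n\<close>. Conversely, the lower end \<open>A n\<close> witnesses that
  \<open>B n\<close> is a peak.\<close>

lemma peak_iff: "peak (folded_fan g) top_pt y \<longleftrightarrow> (\<exists>n. y = zleg (B n))"
proof
  assume "peak (folded_fan g) top_pt y"
  then obtain x where x: "fan_anomalous y x" "\<And>z. fan_anomalous z x \<Longrightarrow> fan_below z y"
    by (auto simp: peak_def)
  obtain a b where ab: "a < b" "folds a b" "x = zleg a" "y = zleg b" using x(1) anomalous_iff by auto
  then obtain n where n: "A n \<le> a" "b \<le> B n" using folds_iff by blast
  have "fan_anomalous (zleg (B n)) x" using anomalous_iff folds_iff[of a "B n"] ab n by force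
  then have "B n \<le> b" using x(2)[of "zleg (B n)"] ab below_zleg[of b "B n"] B_in[of n] folds_in[of a b] by simp
  then show "\<exists>n. y = zleg (B n)" using ab n by (metis order_antisym)
next
  assume "\<exists>n. y = zleg (B n)"
  then obtain n where y: "y = zleg (B n)" by blast
  have "fan_anomalous y (zleg (A n))" using anomalous_iff folds_AB AB y by blast
  moreover have "fan_below z y" if "fan_anomalous z (zleg (A n))" for z
  proof -
    note z = that
    obtain a b where ab: "a < b" "folds a b" "zleg (A n) = zleg a" "z = zleg b"
      using z unfolding anomalous_iff by blast
    have an: "a = A n" using ab(3) by simp
    obtain m where m: "A m \<le> a" "b \<le> B m" using ab folds_iff by blast
    \<comment> \<open>The intervals are disjoint as half-open ones: if the previous one touches
      \<open>A n\<close>, it has nothing above \<open>A n\<close>.\<close>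
    then have "m = n" using cell_unique[of m a n] ab an AB by auto
    moreover have "b \<in> {0..1}" using ab(2) folds_in by blast
    ultimately show ?thesis using below_zleg[OF B_in] m ab y by simp
  qed
  ultimately show "peak (folded_fan g) top_pt y" unfolding peak_def by blast
qed

text \<open>This makes touching visible to the topology: a fold can start at a peak only if the next
  interval begins exactly there.\<close>

lemma anomalous_peak_iff: "(\<exists>z. fan_anomalous z (zleg (B n))) \<longleftrightarrow> B n = A (Suc n)"
proof
  assume "\<exists>z. fan_anomalous z (zleg (B n))"
  then obtain a b where ab: "a < b" "folds a b" "zleg (B n) = zleg a" using anomalous_iff by auto
  have "a = B n" using ab(3) by simp
  then obtain m where m: "A m \<le> B n" "B n < B m" using folds_iff ab by force
  then have "n < m" using mono_B[of m n] by (cases m n rule: linorder_cases) simp_all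
  then show "B n = A (Suc n)" using m BA[of n] mono_A[of "Suc n" m] by simp
next
  assume "B n = A (Suc n)"
  then show "\<exists>z. fan_anomalous z (zleg (B n))" using anomalous_iff AB[of "Suc n"] folds_AB[of "Suc n"] by metis
qed

lemma below_peaks: "fan_below (zleg (B m)) (zleg (B n)) \<longleftrightarrow> m \<le> n"
  using below_zleg[OF B_in[of n] B_in[of m]] mono_B[of m n] mono_B[of n m]
  by (cases m n rule: linorder_cases) simp_all

end

lemma strict_mono_surj_nat:
  fixes p :: "nat \<Rightarrow> nat"
  assumes "strict_mono p" "surj p"
  shows "p n = n"
proof -
  obtain q where q: "\<And>n. p (q n) = n" using assms(2) by (metis surjD)
  have "strict_mono q" using q assms(1) by (metis strict_mono_def strict_mono_less)
  then have "n \<le> q n" using strict_mono_imp_increasing by blast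
  then have "p n \<le> n" using q assms(1) by (metis strict_mono_less_eq)
  then show ?thesis using strict_mono_imp_increasing[OF assms(1), of n] by simp
qed

text \<open>A homeomorphism fixes the top, the only ramification point, and hence preserves the arc
  order, anomalies and peaks. On the peaks it acts as an order automorphism of the natural numbers,
  which is the identity, so the \<open>n\<close>-th peaks correspond.\<close>

lemma step_folding_invariant:
  assumes "step_folding g A B" "step_folding h A' B'" "folded_fan g homeomorphic folded_fan h"
  shows "B n = A (Suc n) \<longleftrightarrow> B' n = A' (Suc n)"
proof -
  interpret G: step_folding g A B by fact
  interpret H: step_folding h A' B' by fact
  let ?X = "folded_fan g" and ?Y = "folded_fan h" and ?v = "\<lambda>_::nat. 0::real"
  obtain f k where f: "homeomorphism ?X ?Y f k" using assms(3) by (auto simp: homeomorphic_def)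
  note k = homeomorphism_symD[OF f]
  have fv: "f ?v = ?v" using H.ramification_only_v ramification_point_image[OF f G.ramification_v] .
  have kv: "k ?v = ?v" using G.ramification_only_v ramification_point_image[OF k H.ramification_v] .
  note image = below_image[OF f, of ?v, unfolded fv] anomalous_image[OF f G.v_in_X, unfolded fv] peak_image[OF f G.v_in_X, unfolded fv]
  note inv = below_image[OF k, of ?v, unfolded kv] anomalous_image[OF k H.v_in_X, unfolded kv] peak_image[OF k H.v_in_X, unfolded kv]
  have GX: "G.zleg (B m) \<in> ?X" for m using G.in_X G.B_in zero_in_codes by blast
  have HX: "H.zleg (B' m) \<in> ?Y" for m using H.in_X H.B_in zero_in_codes by blast
  have "\<forall>m. \<exists>j. f (G.zleg (B m)) = H.zleg (B' j)"
    using image(3) G.peak_iff H.peak_iff by blast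
  then obtain p where p: "\<And>m. f (G.zleg (B m)) = H.zleg (B' (p m))" by metis
  have kp: "k (H.zleg (B' (p m))) = G.zleg (B m)" for m
    using homeomorphism_apply1[OF f GX] p by metis
  have "i \<le> j \<longleftrightarrow> p i \<le> p j" for i j
    using image(1)[of "G.zleg (B i)" "G.zleg (B j)"] inv(1)[of "H.zleg (B' (p i))" "H.zleg (B' (p j))"]
    unfolding kp p G.below_peaks H.below_peaks by blast
  then have mono: "strict_mono p" by (meson not_le strict_mono_def)
  have "\<exists>m. j = p m" for j
  proof -
    have "peak ?X ?v (k (H.zleg (B' j)))" using inv(3) H.peak_iff by blast
    then obtain m where "k (H.zleg (B' j)) = G.zleg (B m)" using G.peak_iff by blast
    then have "H.zleg (B' j) = H.zleg (B' (p m))" using homeomorphism_apply2[OF f HX] p by metis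
    then have "B' j = B' (p m)" by simp
    then have "j = p m"
      using H.mono_B[of j "p m"] H.mono_B[of "p m" j] by (cases j "p m" rule: linorder_cases) simp_all
    then show ?thesis by blast
  qed
  then have pn: "p n = n" using strict_mono_surj_nat[OF mono] by (metis surjI)
  have "(\<exists>z. G.fan_anomalous z (G.zleg (B n))) \<longleftrightarrow> (\<exists>z. H.fan_anomalous z (H.zleg (B' n)))"
    using image(2)[of _ "G.zleg (B n)"] inv(2)[of _ "H.zleg (B' n)"] p[of n] kp[of n] unfolding pn by metis
  then show ?thesis unfolding G.anomalous_peak_iff H.anomalous_peak_iff .
qed

section \<open>A family of fold patterns\<close>

text \<open>Piecewise linear on the quarters of the unit interval: up from 0 to 1, down to 0, up to
  1, then constant.\<close>

definition zigzag :: "real \<Rightarrow> real" where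
  "zigzag u = min (4 * u) (min 1 \<bar>4 * u - 2\<bar>)"

text \<open>On the first three quarters the zigzag has height \<open>h\<close>; the last quarter
  climbs from \<open>h\<close> to 1. So the heights from 0 to \<open>h\<close> are folded.\<close>

definition fold_cell :: "real \<Rightarrow> real \<Rightarrow> real" where
  "fold_cell h u = h * zigzag u + (1 - h) * max 0 (4 * u - 3)"

definition edge :: "nat \<Rightarrow> real" where
  "edge n = 1 - (1/2) ^ n"

text \<open>With value 1 the fold fills its cell and touches the next fold; with value 1/2 it leaves
  a gap.\<close>

definition height :: "nat set \<Rightarrow> nat \<Rightarrow> real" where
  "height E n = (if n \<in> E then 1 else 1/2)"

definition turn :: "nat set \<Rightarrow> nat \<Rightarrow> real" where
  "turn E n = edge n + height E n * (1/2) ^ Suc n"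

definition clamp01 :: "real \<Rightarrow> real" where
  "clamp01 u = max 0 (min 1 u)"

text \<open>The \<open>n\<close>-th term is 0 to the left of the \<open>n\<close>-th cell and keeps
  its full value \<open>(1/2) ^ Suc n\<close> to the right of it. The series form gives continuity
  also at 1, where the cells accumulate.\<close>

definition fold_fn :: "nat set \<Rightarrow> real \<Rightarrow> real" where
  "fold_fn E t = (\<Sum>n. (1/2) ^ Suc n * fold_cell (height E n) (clamp01 (2 ^ Suc n * (t - edge n))))"

lemma height_bounds: "1/2 \<le> height E n" "height E n \<le> 1"
  by (simp_all add: height_def)

lemma fold_cell_0 [simp]: "fold_cell h 0 = 0"
  by (simp add: fold_cell_def zigzag_def)

lemma fold_cell_1 [simp]: "fold_cell h 1 = 1"
  by (simp add: fold_cell_def zigzag_def)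

lemma fold_cell_low:
  assumes "u \<le> 3/4"
  shows "fold_cell h u = h * zigzag u"
  using assms by (simp add: fold_cell_def)

lemma fold_cell_high:
  assumes "3/4 \<le> u" "u \<le> 1"
  shows "fold_cell h u = h + (1 - h) * (4 * u - 3)"
proof -
  have "zigzag u = 1" using assms unfolding zigzag_def by linarith
  then show ?thesis using assms by (simp add: fold_cell_def)
qed

lemma zigzag_bounds: "0 \<le> u \<Longrightarrow> 0 \<le> zigzag u" "zigzag u \<le> 1"
  by (auto simp: zigzag_def)

lemma fold_cell_bounds:
  assumes "0 \<le> h" "h \<le> 1" "0 \<le> u" "u \<le> 1"
  shows "0 \<le> fold_cell h u" "fold_cell h u \<le> 1"
proof -
  have z: "0 \<le> zigzag u" "zigzag u \<le> 1" using zigzag_bounds assms by auto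
  have m: "0 \<le> max 0 (4 * u - 3)" "max 0 (4 * u - 3) \<le> 1" using assms by auto
  show "0 \<le> fold_cell h u" unfolding fold_cell_def using assms z m by (intro add_nonneg_nonneg mult_nonneg_nonneg) auto
  have "h * zigzag u \<le> h * 1" "(1 - h) * max 0 (4 * u - 3) \<le> (1 - h) * 1"
    using assms z m by (intro mult_left_mono; simp)+
  then show "fold_cell h u \<le> 1" unfolding fold_cell_def by simp
qed

lemma continuous_fold_cell: "continuous_on S (fold_cell h)"
  unfolding fold_cell_def zigzag_def by (intro continuous_intros)

lemma edge_Suc: "edge (Suc n) = edge n + (1/2) ^ Suc n"
  by (simp add: edge_def)

lemma edge_mono: "m \<le> n \<Longrightarrow> edge m \<le> edge n"
  by (simp add: edge_def power_decreasing)

lemma edge_lt_1: "edge n < 1"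
  by (simp add: edge_def)

lemma edge_nonneg: "0 \<le> edge n"
  by (simp add: edge_def power_le_one)

lemma edge_sum: "edge n = (\<Sum>k<n. (1/2) ^ Suc k)"
  by (induction n) (simp_all add: edge_Suc edge_def)

lemma clamp01_in: "0 \<le> clamp01 u" "clamp01 u \<le> 1"
  by (auto simp: clamp01_def)

lemma edge_cell:
  assumes "0 \<le> t" "t < 1"
  obtains n where "edge n \<le> t" "t < edge (Suc n)"
proof -
  obtain N where "(1/2) ^ N < 1 - t" using real_arch_pow_inv[of "1 - t" "1/2"] assms by auto
  then have "t < edge N" unfolding edge_def by linarith
  then have ex: "\<exists>N. t < edge N" by blast
  define N where "N = (LEAST N. t < edge N)"
  have N: "t < edge N" unfolding N_def by (rule LeastI_ex[OF ex])
  then have "N \<noteq> 0" using assms by (cases "N = 0") (simp_all add: edge_def)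
  then obtain n where n: "N = Suc n" using not0_implies_Suc by blast
  then have "\<not> t < edge n" using not_less_Least[of n "\<lambda>N. t < edge N"] unfolding N_def by simp
  then show thesis using that[of n] N n by simp
qed

section \<open>Values and continuity of the fold functions\<close>

lemma fold_fn_1 [simp]: "fold_fn E 1 = 1"
proof -
  have "clamp01 (2 ^ Suc n * (1 - edge n)) = 1" for n
    by (simp add: clamp01_def edge_def power_one_over)
  then have "fold_fn E 1 = (\<Sum>n. (1/2) ^ Suc n)" by (simp add: fold_fn_def del: power_Suc)
  also have "\<dots> = 1" using power_half_series sums_unique by fastforce
  finally show ?thesis .
qed

lemma fold_fn_cell:
  assumes "edge n \<le> t" "t \<le> edge (Suc n)"
  shows "fold_fn E t = edge n + (1/2) ^ Suc n * fold_cell (height E n) (2 ^ Suc n * (t - edge n))"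
proof -
  let ?f = "\<lambda>k. (1/2) ^ Suc k * fold_cell (height E k) (clamp01 (2 ^ Suc k * (t - edge k)))"
  have inv: "2 ^ Suc k * (1/2) ^ Suc k = (1::real)" for k
    by (metis mult.commute power_mult_distrib nonzero_eq_divide_eq power_one zero_neq_numeral)
  have late: "?f k = 0" if "n < k" for k
  proof -
    have "t - edge k \<le> 0" using assms edge_mono[of "Suc n" k] that by simp
    then have "2 ^ Suc k * (t - edge k) \<le> 0" by (intro mult_nonneg_nonpos) auto
    then have "clamp01 (2 ^ Suc k * (t - edge k)) = 0" unfolding clamp01_def by linarith
    then show ?thesis by simp
  qed
  have early: "?f k = (1/2) ^ Suc k" if "k < n" for k
  proof -
    have "(1/2) ^ Suc k \<le> t - edge k" using assms edge_mono[of "Suc k" n] that edge_Suc[of k] by simp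
    then have "2 ^ Suc k * (1/2) ^ Suc k \<le> 2 ^ Suc k * (t - edge k)" by (intro mult_left_mono) auto
    then have "clamp01 (2 ^ Suc k * (t - edge k)) = 1" unfolding inv by (simp add: clamp01_def)
    then show ?thesis by simp
  qed
  have "0 \<le> 2 ^ Suc n * (t - edge n)" using assms by simp
  moreover have "2 ^ Suc n * (t - edge n) \<le> 2 ^ Suc n * (1/2) ^ Suc n"
    using assms edge_Suc[of n] by (intro mult_left_mono) auto
  ultimately have now: "clamp01 (2 ^ Suc n * (t - edge n)) = 2 ^ Suc n * (t - edge n)"
    unfolding inv by (simp add: clamp01_def)
  have "fold_fn E t = (\<Sum>k\<in>{..<Suc n}. ?f k)"
    unfolding fold_fn_def by (rule suminf_finite) (use late in auto)
  also have "\<dots> = (\<Sum>k<n. ?f k) + ?f n" by simp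
  also have "(\<Sum>k<n. ?f k) = edge n" unfolding edge_sum[of n] by (rule sum.cong[OF refl], rule early) simp
  finally show ?thesis unfolding now .
qed

lemma fold_fn_at:
  assumes "0 \<le> u" "u \<le> 1"
  shows "fold_fn E (edge n + (1/2) ^ Suc n * u) = edge n + (1/2) ^ Suc n * fold_cell (height E n) u"
proof -
  have inv: "2 ^ Suc n * ((1/2) ^ Suc n * u) = u"
    by (simp add: power_one_over)
  have "(1/2) ^ Suc n * u \<le> (1/2) ^ Suc n * 1" using assms by (intro mult_left_mono) auto
  then show ?thesis
    using fold_fn_cell[of n "edge n + (1/2) ^ Suc n * u" E] assms edge_Suc[of n] inv
    by (simp del: power_Suc)
qed

lemma in_cell:
  assumes "edge n \<le> t" "t \<le> edge (Suc n)"
  obtains u where "0 \<le> u" "u \<le> 1" "t = edge n + (1/2) ^ Suc n * u"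
proof
  show "0 \<le> (t - edge n) / (1/2) ^ Suc n" using assms by simp
  show "(t - edge n) / (1/2) ^ Suc n \<le> 1" using assms edge_Suc[of n] by (simp add: divide_le_eq del: power_Suc)
  show "t = edge n + (1/2) ^ Suc n * ((t - edge n) / (1/2) ^ Suc n)" by (simp del: power_Suc)
qed

lemma fold_fn_range:
  assumes "edge n \<le> t" "t \<le> edge (Suc n)"
  shows "edge n \<le> fold_fn E t" "fold_fn E t \<le> edge (Suc n)"
proof -
  obtain u where u: "0 \<le> u" "u \<le> 1" "t = edge n + (1/2) ^ Suc n * u" using in_cell assms by blast
  have b: "0 \<le> fold_cell (height E n) u" "fold_cell (height E n) u \<le> 1"
    using fold_cell_bounds[of "height E n" u] height_bounds[of E n] u by auto
  have "(1/2) ^ Suc n * fold_cell (height E n) u \<le> (1/2) ^ Suc n * 1"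
    using b by (intro mult_left_mono) auto
  then show "edge n \<le> fold_fn E t" "fold_fn E t \<le> edge (Suc n)"
    using fold_fn_at[of u E n] u b edge_Suc[of n] by (simp_all del: power_Suc)
qed

text \<open>Each cell is mapped into itself, so the value stays above an edge once the parameter has
  passed it. This keeps folds from reaching across cells.\<close>

lemma fold_fn_ge:
  assumes "edge n \<le> t" "t \<le> 1"
  shows "edge n \<le> fold_fn E t"
proof (cases "t = 1")
  case True
  then show ?thesis using edge_lt_1[of n] by simp
next
  case False
  then obtain m where m: "edge m \<le> t" "t < edge (Suc m)"
    using edge_cell[of t] assms edge_nonneg[of n] by auto
  have "n \<le> m"
  proof (rule ccontr)
    assume "\<not> n \<le> m"
    then have "edge (Suc m) \<le> edge n" by (intro edge_mono) simp
    then show False using m assms by simp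
  qed
  then show ?thesis using fold_fn_range(1)[of m t E] m edge_mono[of n m] by simp
qed

text \<open>The Weierstrass test applies with the majorant \<open>(1/2) ^ Suc n\<close>, since
  clamped cells take values in the unit interval.\<close>

lemma continuous_fold_fn: "continuous_on S (fold_fn E)"
proof -
  let ?f = "\<lambda>n t. (1/2) ^ Suc n * fold_cell (height E n) (clamp01 (2 ^ Suc n * (t - edge n)))"
  have sm: "summable (\<lambda>n. (1/2 :: real) ^ Suc n)" using power_half_series sums_summable by blast
  have "norm (?f n t) \<le> (1/2) ^ Suc n" for n t
  proof -
    have "0 \<le> fold_cell (height E n) (clamp01 (2 ^ Suc n * (t - edge n)))"
      "fold_cell (height E n) (clamp01 (2 ^ Suc n * (t - edge n))) \<le> 1"
      using fold_cell_bounds[of "height E n"] height_bounds[of E n] clamp01_in by auto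
    then show ?thesis by (simp add: abs_mult mult_left_le)
  qed
  then have "uniform_limit S (\<lambda>n t. \<Sum>i<n. ?f i t) (\<lambda>t. \<Sum>i. ?f i t) sequentially"
    by (intro Weierstrass_m_test[OF _ sm])
  moreover have "continuous_on S (\<lambda>t. \<Sum>i<n. ?f i t)" for n
  proof (intro continuous_on_sum continuous_on_mult continuous_on_const)
    fix i
    have "continuous_on S (\<lambda>t. clamp01 (2 ^ Suc i * (t - edge i)))"
      unfolding clamp01_def by (intro continuous_intros)
    then show "continuous_on S (\<lambda>t. fold_cell (height E i) (clamp01 (2 ^ Suc i * (t - edge i))))"
      by (rule continuous_on_compose2[OF continuous_fold_cell[of UNIV]]) simp
  qed
  ultimately have "continuous_on S (\<lambda>t. \<Sum>i. ?f i t)"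
    by (intro uniform_limit_theorem[OF always_eventually]) auto
  then show ?thesis by (simp add: fold_fn_def[abs_def])
qed

lemma fold_fn_0 [simp]: "fold_fn E 0 = 0"
  using fold_fn_at[of 0 E 0] by (simp add: edge_def)

interpretation fold_fn: folding "fold_fn E" for E
proof
  show "continuous_on {0..1} (fold_fn E)" by (rule continuous_fold_fn)
  show "fold_fn E 0 = 0" by simp
  show "fold_fn E ` {0..1} = {0..1}"
  proof
    show "fold_fn E ` {0..1} \<subseteq> {0..1}"
    proof
      fix y assume "y \<in> fold_fn E ` {0..1}"
      then obtain t where t: "0 \<le> t" "t \<le> 1" "y = fold_fn E t" by auto
      show "y \<in> {0..1}"
      proof (cases "t = 1")
        case False
        then obtain n where n: "edge n \<le> t" "t < edge (Suc n)" using edge_cell[of t] t by auto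
        then show ?thesis
          using fold_fn_range[of n t E] edge_nonneg[of n] edge_lt_1[of "Suc n"] t by simp
      qed (use t in simp)
    qed
    show "{0..1} \<subseteq> fold_fn E ` {0..1}"
    proof
      fix y :: real assume "y \<in> {0..1}"
      then obtain t where "0 \<le> t" "t \<le> 1" "fold_fn E t = y"
        using IVT'[of "fold_fn E" 0 y 1] continuous_fold_fn by auto
      then show "y \<in> fold_fn E ` {0..1}" by auto
    qed
  qed
qed

text \<open>A descent happens inside one cell and cannot start above the turning height, because
  larger values occur only in the last quarter, where the cell function does not decrease.
  Conversely, the first rise and the following fall of the zigzag realise every pair.\<close>

lemma folds_fold_fn_iff:
  assumes "a < b"
  shows "fold_fn.folds E a b \<longleftrightarrow> (\<exists>n. edge n \<le> a \<and> b \<le> turn E n)"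
proof
  assume "fold_fn.folds E a b"
  then obtain s t where st: "0 \<le> s" "s \<le> t" "t \<le> 1" "fold_fn E s = b" "fold_fn E t = a"
    by (auto simp: fold_fn.folds_def)
  have "s \<noteq> t" using st assms by auto
  then obtain n where n: "edge n \<le> s" "s < edge (Suc n)" using edge_cell[of s] st by auto
  \<comment> \<open>Past the next edge the value would be at least that edge, hence no smaller than
    \<open>b\<close>.\<close>
  have tn: "t < edge (Suc n)"
  proof (rule ccontr)
    assume "\<not> t < edge (Suc n)"
    then have "edge (Suc n) \<le> a" using fold_fn_ge[of "Suc n" t E] st by simp
    then show False using fold_fn_range(2)[of n s E] n st assms by simp
  qed
  let ?h = "height E n" and ?w = "(1/2 :: real) ^ Suc n"
  obtain u where u: "0 \<le> u" "u \<le> 1" "s = edge n + ?w * u" using in_cell[of n s] n by auto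
  obtain u' where u': "0 \<le> u'" "u' \<le> 1" "t = edge n + ?w * u'" using in_cell[of n t] n tn st by auto
  have w: "0 < ?w" by simp
  have ab: "b = edge n + ?w * fold_cell ?h u" "a = edge n + ?w * fold_cell ?h u'"
    using fold_fn_at u u' st by metis+
  have uu: "u \<le> u'" using st(2) u(3) u'(3) w by (simp del: power_Suc)
  have less: "fold_cell ?h u' < fold_cell ?h u" using assms ab w by (simp del: power_Suc)
  have "fold_cell ?h u \<le> ?h"
  proof (rule ccontr)
    assume gt: "\<not> fold_cell ?h u \<le> ?h"
    have "3/4 \<le> u"
    proof (rule ccontr)
      assume "\<not> 3/4 \<le> u"
      then have "fold_cell ?h u = ?h * zigzag u" by (intro fold_cell_low) simp
      also have "\<dots> \<le> ?h * 1"
        using zigzag_bounds(2) height_bounds[of E n] by (intro mult_left_mono) auto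
      finally show False using gt by simp
    qed
    moreover have "(1 - ?h) * (4 * u - 3) \<le> (1 - ?h) * (4 * u' - 3)"
      using uu height_bounds[of E n] by (intro mult_left_mono) auto
    ultimately show False using fold_cell_high u u' uu less by simp
  qed
  then have "?w * fold_cell ?h u \<le> ?w * ?h" using w by (intro mult_left_mono) auto
  then have "b \<le> turn E n" unfolding ab turn_def by (simp add: mult.commute)
  moreover have "edge n \<le> a" using fold_fn_ge[of n t E] n st by simp
  ultimately show "\<exists>n. edge n \<le> a \<and> b \<le> turn E n" by blast
next
  assume "\<exists>n. edge n \<le> a \<and> b \<le> turn E n"
  then obtain n where n: "edge n \<le> a" "b \<le> turn E n" by blast
  define h w where "h = height E n" and "w = (1/2 :: real) ^ Suc n"
  have h: "0 < h" "h \<le> 1" using height_bounds[of E n] by (auto simp: h_def)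
  have w: "0 < w" by (simp add: w_def)
  \<comment> \<open>The heights \<open>a\<close> and \<open>b\<close> as fractions of the folded
    part of the cell.\<close>
  define \<alpha> \<beta> where "\<alpha> = (a - edge n) / (w * h)" and "\<beta> = (b - edge n) / (w * h)"
  have a: "a = edge n + w * (h * \<alpha>)" and b: "b = edge n + w * (h * \<beta>)" using h w by (auto simp: \<alpha>_def \<beta>_def)
  have "b - edge n \<le> w * h" using n by (simp add: turn_def h_def w_def mult.commute)
  then have b1: "\<beta> \<le> 1" using h w by (simp add: \<beta>_def divide_le_eq)
  have a0: "0 \<le> \<alpha>" using n h w by (simp add: \<alpha>_def)
  have ab: "\<alpha> < \<beta>" unfolding \<alpha>_def \<beta>_def using assms h w by (intro divide_strict_right_mono) auto
  \<comment> \<open>\<open>s\<close> lies on the first rising quarter and \<open>t\<close> on the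
    falling quarter that follows.\<close>
  define s t where "s = edge n + w * (\<beta> / 4)" and "t = edge n + w * (1/2 - \<alpha> / 4)"
  have z: "zigzag (\<beta> / 4) = \<beta>" "zigzag (1/2 - \<alpha> / 4) = \<alpha>"
    using a0 ab b1 by (auto simp: zigzag_def)
  have "fold_fn E s = edge n + w * fold_cell h (\<beta> / 4)"
    unfolding s_def w_def h_def using a0 ab b1 by (intro fold_fn_at) auto
  then have "fold_fn E s = b" using fold_cell_low[of "\<beta> / 4" h] b1 b z by simp
  moreover have "fold_fn E t = edge n + w * fold_cell h (1/2 - \<alpha> / 4)"
    unfolding t_def w_def h_def using a0 ab b1 by (intro fold_fn_at) auto
  then have "fold_fn E t = a" using fold_cell_low[of "1/2 - \<alpha> / 4" h] a0 a z by simp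
  moreover have "0 \<le> s" using edge_nonneg[of n] w a0 ab by (simp add: s_def)
  moreover have "s \<le> t" unfolding s_def t_def using w ab b1 a0 by (intro add_left_mono mult_left_mono) auto
  moreover have "t \<le> 1"
  proof -
    have "w * (1/2 - \<alpha> / 4) \<le> w * 1" using w a0 by (intro mult_left_mono) auto
    moreover have "edge (Suc n) = edge n + w" by (simp add: edge_Suc w_def)
    ultimately show ?thesis using edge_lt_1[of "Suc n"] unfolding t_def by linarith
  qed
  ultimately show "fold_fn.folds E a b" unfolding fold_fn.folds_def by blast
qed

section \<open>Recovering the index set from the fan\<close>

lemma step_folding_fold_fn: "step_folding (fold_fn E) edge (turn E)"
proof
  fix n
  show "edge n < turn E n" using height_bounds(1)[of E n] by (simp add: turn_def)
  have "height E n * (1/2) ^ Suc n \<le> 1 * (1/2) ^ Suc n"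
    using height_bounds(2) by (intro mult_right_mono) auto
  then show "turn E n \<le> edge (Suc n)" unfolding turn_def edge_Suc by simp
qed (rule folds_fold_fn_iff)

lemma turn_eq_edge_iff: "turn E n = edge (Suc n) \<longleftrightarrow> n \<in> E"
  by (simp add: turn_def edge_Suc height_def)

lemma folded_fan_homeomorphic_imp_eq:
  assumes "folded_fan (fold_fn E) homeomorphic folded_fan (fold_fn F)"
  shows "E = F"
  using step_folding_invariant[OF step_folding_fold_fn step_folding_fold_fn assms]
  by (auto simp: turn_eq_edge_iff)

lemma uncountable_nat_sets: "uncountable (UNIV :: nat set set)"
proof
  assume "countable (UNIV :: nat set set)"
  then have "from_nat_into UNIV ` UNIV = Pow (UNIV :: nat set)"
    using range_from_nat_into[of "UNIV :: nat set set"] by simp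
  then show False using Cantors_theorem[of UNIV] by blast
qed

(* Every compact metric space embeds in nat => real with the product topology, so its subsets
   represent all continua up to homeomorphism. *)
theorem theorem3p23:
  shows "\<exists>\<H> :: (nat \<Rightarrow> real) set set.
           uncountable \<H> \<and>
           (\<forall>X\<in>\<H>. fan X) \<and>
           (\<forall>X\<in>\<H>. \<forall>Y\<in>\<H>. X \<noteq> Y \<longrightarrow> \<not> X homeomorphic Y) \<and>
           (\<forall>X\<in>\<H>. nonsmooth_fan X) \<and>
           (\<forall>X\<in>\<H>. \<exists>f. transitive_homeomorphism X f)"
proof (rule exI[of _ "range (\<lambda>E. folded_fan (fold_fn E))"], intro conjI ballI impI)
  let ?X = "\<lambda>E. folded_fan (fold_fn E)"
  \<comment> \<open>Equal fans are homeomorphic, so the invariant also shows that different index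
    sets give different fans.\<close>
  have "inj ?X" using folded_fan_homeomorphic_imp_eq homeomorphic_refl by (metis injI)
  then show "uncountable (range ?X)" using uncountable_nat_sets countable_image_inj_on by blast
  fix X assume "X \<in> range ?X"
  then obtain E where E: "X = ?X E" by blast
  note S = step_folding.folds_AB[OF step_folding_fold_fn] step_folding.AB[OF step_folding_fold_fn]
  show "fan X" unfolding E by (rule fold_fn.fan_X)
  show "nonsmooth_fan X" unfolding E by (rule fold_fn.nonsmooth_folded_fan[OF S(1,2)])
  show "\<exists>f. transitive_homeomorphism X f" unfolding E by (rule fold_fn.transitive_homeomorphism_folded_fan)
  fix Y assume "Y \<in> range ?X" "X \<noteq> Y"
  then show "\<not> X homeomorphic Y" using folded_fan_homeomorphic_imp_eq E by blast
qed

end
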